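(* Assume that for every $n\in\mathbb N$ there are constants $0<m_{2n}\le M_{2n}$ and $M_{2n+1}>0$ such that i) $m_{2n}\|v\|_{U_1}^2\le\|B_1^*(t)v\|_{U_1}^2\le M_{2n}\|v\|_{U_1}^2$ for all $t\in I_{2n}$, $v\in V$; ii) $\|B_2^*(t)v\|_{U_2}^2\le M_{2n+1}\|v\|_W^2$ for all $t\in I_{2n+1}$, $v\in H$. Assume that $T_{2n}=T^*$ for all $n\in\mathbb N$, with $T^*\ge\tau$, and $T_{2n+1}=\tilde T$ for all $n\in\mathbb N$, with $\tilde T\le\tau$. Assume that there is a time $\overline T<T^*$ such that, for every $n\in\mathbb N$ and every $T$ with $T^*\ge T>\overline T$, there is a constant $d_n$, depending on $T$ but independent of the initial data, such that $$E_S(w,t_{2n}+T)\le d_n\int_{t_{2n}}^{t_{2n}+T}\|B_1^*(t)w_t(t)\|_{U_1}^2\,dt$$ for every weak solution $w$ of $$w_{tt}(t)+Aw(t)+B_1(t)B_1^*(t)w_t(t)=0,\ t\in(t_{2n},t_{2n+1}),\qquad w(t_{2n})=w_0^n,\ w_t(t_{2n})=w_1^n,$$ with $(w_0^n,w_1^n)\in V\times H$. Set $\hat d_n=\frac{d_n}{d_n+1}$, where $d_n$ is the constant corresponding to the time $T=T_{2n}=T^*$. If $$\sup_{n\in\mathbb N}\left[e^{CM_{2n+1}\tilde T}(\hat d_n+1)-1\right]<1,$$ then there exist two positive constants $\hat\gamma,\hat\mu$ such that $$E_S(u,t)\le\hat\gamma e^{-\hat\mu t}E_S(u,0),\qquad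 t>0,$$ for any solution $u$ of the delayed problem.
   Context: $\mathbb N=\{0,1,2,\dots\}$. $H$ is a real Hilbert space; $A:\mathcal D(A)\to H$ is a positive self-adjoint operator with compact inverse; $V=\mathcal D(A^{1/2})$ with $\|v\|_V=\|A^{1/2}v\|_H$; $V'$ is the dual of $V$ with pivot space $H$. $U_1,U_2$ are real Hilbert spaces identified with their duals, and $V$ is (continuously) embedded into $U_1$. $W$ is a Hilbert space in which $H$ is continuously embedded, with $C>0$ such that $\|v\|_W^2\le C\|v\|_H^2$ for all $v\in H$. $\tau>0$ is fixed. $0=t_0<t_1<t_2<\cdots$ is a sequence, $I_n=[t_n,t_{n+1})$, $T_n=t_{n+1}-t_n$. $B_1(t)\in\mathcal L(U_1,V')$ (possibly unbounded as an operator into $H$) with adjoint $B_1^*(t)\in\mathcal L(V,U_1)$, and $B_2(t)\in\mathcal L(U_2,H)$, satisfy for all $n$: $B_2(t)=0$ for $t\in I_{2n}$, $B_1(t)=0$ for $t\in I_{2n+1}$, $B_2\in C([t_{2n+1},t_{2n+2}];\mathcal L(U_2,H))$, and either $B_1\in C^1([t_{2n},t_{2n+1}];\mathcal L(U_1,H))$, or $B_1(t)=\sqrt{b_1(t)}\,C_n$ on $I_{2n}$ with $C_n\in\mathcal L(U_1,V')$, $b_1\in W^{2,\infty}(t_{2n},t_{2n+1})$ and $b_1(t)>0$ for $t\in I_{2n}$. Delayed problem: $$u_{tt}(t)+Au(t)+B_1(t)B_1^*(t)u_t(t)+B_2(t)B_2^*(t)u_t(t-\tau)=0,\ t>0,\qquad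 u(0)=u_0\in V,\ u_t(0)=u_1\in H.$$ The delay term is $0$ whenever $B_2(t)=0$, in particular on $[0,t_1)\supset[0,\tau)$, so no history data are needed. A solution is a mild solution $u\in C([0,\infty);V)\cap C^1([0,\infty);H)$: on intervals $I_{2n+1}$ the equation holds in $V'$; on compact subintervals $J$ of $I_{2n}$, $u$ is a limit in $C(J;V)\cap C^1(J;H)$ of strong solutions (with $u_t\in V$ and $Au+B_1B_1^*u_t\in H$). Weak solutions of the damped (undelayed) problem on $(t_{2n},t_{2n+1})$ are understood in the same sense, and $B_1^*w_t$ denotes the corresponding $L^2$-in-time limit. Standard energy: $E_S(u,t):=\frac12\left(\|u(t)\|_V^2+\|u_t(t)\|_H^2\right)$. *)

theory Defs
  imports "HOL-Analysis.Analysis"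
begin

text \<open>
  An unbounded operator in \<open>H\<close> is a pair \<open>D\<close>, \<open>A\<close> of a domain and a function that is
  only looked at on \<open>D\<close>.  The last conjunct below says that the graph of \<open>A\<close> is equal
  to the graph of its adjoint, domains included.
\<close>

definition self_adjoint_op :: "'h::real_inner set \<Rightarrow> ('h \<Rightarrow> 'h) \<Rightarrow> bool" where
  "self_adjoint_op D A \<longleftrightarrow>
     subspace D \<and> closure D = UNIV \<and>
     (\<forall>x\<in>D. \<forall>y\<in>D. A (x + y) = A x + A y) \<and>
     (\<forall>c. \<forall>x\<in>D. A (c *\<^sub>R x) = c *\<^sub>R A x) \<and>
     (\<forall>v w. (\<forall>x\<in>D. A x \<bullet> v = x \<bullet> w) \<longleftrightarrow> v \<in> D \<and> A v = w)"

definition positive_op :: "'h::real_inner set \<Rightarrow> ('h \<Rightarrow> 'h) \<Rightarrow> bool" where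
  "positive_op D A \<longleftrightarrow> (\<forall>x\<in>D. 0 \<le> A x \<bullet> x)"

definition has_compact_inverse :: "'h::real_inner set \<Rightarrow> ('h \<Rightarrow> 'h) \<Rightarrow> bool" where
  "has_compact_inverse D A \<longleftrightarrow>
     bij_betw A D UNIV \<and>
     (\<forall>B. bounded B \<longrightarrow> compact (closure (inv_into D A ` B)))"

text \<open>
  \<open>(DS, S)\<close> is the operator \<open>A\<^sup>1\<^sup>/\<^sup>2\<close>: the (unique) positive self-adjoint operator whose
  square, with its natural domain, is \<open>A\<close>.
\<close>

definition is_sqrt_op ::
    "'h::real_inner set \<Rightarrow> ('h \<Rightarrow> 'h) \<Rightarrow> 'h set \<Rightarrow> ('h \<Rightarrow> 'h) \<Rightarrow> bool" where
  "is_sqrt_op DS S D A \<longleftrightarrow>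
     self_adjoint_op DS S \<and> positive_op DS S \<and>
     D = {x \<in> DS. S x \<in> DS} \<and> (\<forall>x\<in>D. S (S x) = A x)"

text \<open>
  \<open>V = \<D>(A\<^sup>1\<^sup>/\<^sup>2)\<close> with \<open>\<parallel>v\<parallel>\<^sub>V = \<parallel>A\<^sup>1\<^sup>/\<^sup>2 v\<parallel>\<^sub>H\<close> is carried by a type of its own; \<open>j\<close> is the
  inclusion of \<open>V\<close> into \<open>H\<close>.
\<close>

definition form_domain ::
    "('v::real_inner \<Rightarrow>\<^sub>L 'h::real_inner) \<Rightarrow> 'h set \<Rightarrow> ('h \<Rightarrow> 'h) \<Rightarrow> bool" where
  "form_domain j DS S \<longleftrightarrow>
     inj (blinfun_apply j) \<and> range (blinfun_apply j) = DS \<and>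
     (\<forall>v. norm v = norm (S (j v)))"

text \<open>
  \<open>V'\<close> is the type of bounded functionals on \<open>V\<close>.  \<open>pivot j\<close> is the embedding of \<open>H\<close>
  into \<open>V'\<close>, \<open>h \<mapsto> (v \<mapsto> \<langle>h, v\<rangle>\<^sub>H)\<close>, and \<open>ext_A\<close> the bounded extension \<open>V \<rightarrow> V'\<close> of \<open>A\<close>,
  which is \<open>\<langle>A u, v\<rangle> = \<langle>A\<^sup>1\<^sup>/\<^sup>2 u, A\<^sup>1\<^sup>/\<^sup>2 v\<rangle>\<^sub>H = \<langle>u, v\<rangle>\<^sub>V\<close>.
\<close>

definition pivot :: "('v::real_inner \<Rightarrow>\<^sub>L 'h::real_inner) \<Rightarrow> 'h \<Rightarrow> 'v \<Rightarrow>\<^sub>L real" where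
  "pivot j h = blinfun_inner_left h o\<^sub>L j"

definition ext_A :: "'v::real_inner \<Rightarrow> 'v \<Rightarrow>\<^sub>L real" where
  "ext_A u = blinfun_inner_left u"

text \<open>Adjoints; \<open>U\<^sub>1\<close> and \<open>U\<^sub>2\<close> are identified with their duals, and \<open>H\<close> is the pivot space.\<close>

definition is_adjoint_dual ::
    "('u::real_inner \<Rightarrow>\<^sub>L ('v::real_inner \<Rightarrow>\<^sub>L real)) \<Rightarrow> ('v \<Rightarrow>\<^sub>L 'u) \<Rightarrow> bool" where
  "is_adjoint_dual B Bs \<longleftrightarrow> (\<forall>x v. blinfun_apply (B x) v = x \<bullet> Bs v)"

definition is_adjoint ::
    "('u::real_inner \<Rightarrow>\<^sub>L 'h::real_inner) \<Rightarrow> ('h \<Rightarrow>\<^sub>L 'u) \<Rightarrow> bool" where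
  "is_adjoint B Bs \<longleftrightarrow> (\<forall>x h. B x \<bullet> h = x \<bullet> Bs h)"

definition C1_on :: "real set \<Rightarrow> (real \<Rightarrow> 'a::real_normed_vector) \<Rightarrow> bool" where
  "C1_on I F \<longleftrightarrow>
     (\<exists>F'. continuous_on I F' \<and> (\<forall>s\<in>I. (F has_vector_derivative F' s) (at s within I)))"

text \<open>The Sobolev space \<open>W\<^sup>2\<^sup>,\<^sup>\<infinity>(a, b)\<close>, by weak derivatives.\<close>

definition test_function :: "real \<Rightarrow> real \<Rightarrow> (real \<Rightarrow> real) \<Rightarrow> bool" where
  "test_function a b \<phi> \<longleftrightarrow>
     (\<forall>k x. (deriv ^^ k) \<phi> field_differentiable at x) \<and>
     (\<exists>c d. a < c \<and> c \<le> d \<and> d < b \<and> (\<forall>x. x \<notin> {c..d} \<longrightarrow> \<phi> x = 0))"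

definition Linf_on :: "real \<Rightarrow> real \<Rightarrow> (real \<Rightarrow> real) \<Rightarrow> bool" where
  "Linf_on a b f \<longleftrightarrow>
     set_borel_measurable lborel {a<..<b} f \<and>
     (\<exists>K. AE x in lborel. x \<in> {a<..<b} \<longrightarrow> \<bar>f x\<bar> \<le> K)"

definition weak_derivative_on ::
    "real \<Rightarrow> real \<Rightarrow> (real \<Rightarrow> real) \<Rightarrow> (real \<Rightarrow> real) \<Rightarrow> bool" where
  "weak_derivative_on a b f g \<longleftrightarrow>
     (\<forall>\<phi>. test_function a b \<phi> \<longrightarrow>
        (LINT x:{a<..<b}|lborel. f x * deriv \<phi> x) = - (LINT x:{a<..<b}|lborel. g x * \<phi> x))"

definition W2inf :: "real \<Rightarrow> real \<Rightarrow> (real \<Rightarrow> real) \<Rightarrow> bool" where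
  "W2inf a b f \<longleftrightarrow>
     Linf_on a b f \<and>
     (\<exists>g h. Linf_on a b g \<and> Linf_on a b h \<and>
        weak_derivative_on a b f g \<and> weak_derivative_on a b g h)"

text \<open>
  The two admissible forms of \<open>B\<^sub>1\<close> on an interval \<open>[a, b)\<close>.  In the first one the
  regularity on \<open>[a, b]\<close> is that of an extension of the restriction of \<open>B\<^sub>1\<close> to \<open>[a, b)\<close>, because
  the value of \<open>B\<^sub>1\<close> at \<open>b\<close> belongs to the next interval.  In the second one \<open>\<beta>\<close> is the
  continuous representative of its Sobolev class.
\<close>

definition B1_smooth_bounded ::
    "('v::real_inner \<Rightarrow>\<^sub>L 'h::real_inner) \<Rightarrow> (real \<Rightarrow> 'u::real_inner \<Rightarrow>\<^sub>L ('v \<Rightarrow>\<^sub>L real)) \<Rightarrow>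
     real \<Rightarrow> real \<Rightarrow> bool" where
  "B1_smooth_bounded j B1 a b \<longleftrightarrow>
     (\<exists>F :: real \<Rightarrow> 'u \<Rightarrow>\<^sub>L 'h. C1_on {a..b} F \<and>
        (\<forall>s\<in>{a..<b}. \<forall>x. B1 s x = pivot j (blinfun_apply (F s) x)))"

definition B1_scaled ::
    "(real \<Rightarrow> 'u::real_inner \<Rightarrow>\<^sub>L ('v::real_inner \<Rightarrow>\<^sub>L real)) \<Rightarrow> real \<Rightarrow> real \<Rightarrow> bool" where
  "B1_scaled B1 a b \<longleftrightarrow>
     (\<exists>\<beta> K. W2inf a b \<beta> \<and> continuous_on {a..<b} \<beta> \<and> (\<forall>s\<in>{a..<b}. 0 < \<beta> s) \<and>
        (\<forall>s\<in>{a..<b}. B1 s = sqrt (\<beta> s) *\<^sub>R K))"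

definition B2_continuous ::
    "(real \<Rightarrow> 'u::real_inner \<Rightarrow>\<^sub>L 'h::real_inner) \<Rightarrow> real \<Rightarrow> real \<Rightarrow> bool" where
  "B2_continuous B2 a b \<longleftrightarrow>
     (\<exists>G. continuous_on {a..b} G \<and> (\<forall>s\<in>{a..<b}. B2 s = G s))"

text \<open>
  \<open>C(I; V) \<inter> C\<^sup>1(I; H)\<close>: here, and below, the time derivative \<open>wt\<close> is carried along
  with \<open>w\<close>, since it takes its values in \<open>H\<close> and not in \<open>V\<close>.
\<close>

definition finite_energy ::
    "('v::real_inner \<Rightarrow>\<^sub>L 'h::real_inner) \<Rightarrow> real set \<Rightarrow> (real \<Rightarrow> 'v) \<Rightarrow> (real \<Rightarrow> 'h) \<Rightarrow> bool" where
  "finite_energy j I w wt \<longleftrightarrow>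
     continuous_on I w \<and> continuous_on I wt \<and>
     (\<forall>s\<in>I. ((\<lambda>r. j (w r)) has_vector_derivative wt s) (at s within I))"

definition energy :: "(real \<Rightarrow> 'v::real_inner) \<Rightarrow> (real \<Rightarrow> 'h::real_inner) \<Rightarrow> real \<Rightarrow> real" where
  "energy w wt t = (1/2) * ((norm (w t))\<^sup>2 + (norm (wt t))\<^sup>2)"

text \<open>
  Strong solutions of \<open>z\<^sub>t\<^sub>t + A z + B\<^sub>1 B\<^sub>1\<^sup>* z\<^sub>t = 0\<close> on \<open>J\<close>: \<open>(z, z\<^sub>t)\<close> is of class \<open>C\<^sup>1\<close> with
  values in \<open>V \<times> H\<close>, with \<open>z\<^sub>t \<in> V\<close>.  The equation identifies \<open>A z + B\<^sub>1 B\<^sub>1\<^sup>* z\<^sub>t \<in> V'\<close> with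
  the element \<open>- z\<^sub>t\<^sub>t\<close> of \<open>H\<close>.
\<close>

definition strong_solution ::
    "('v::real_inner \<Rightarrow>\<^sub>L 'h::real_inner) \<Rightarrow> (real \<Rightarrow> 'u::real_inner \<Rightarrow>\<^sub>L ('v \<Rightarrow>\<^sub>L real)) \<Rightarrow>
     (real \<Rightarrow> 'v \<Rightarrow>\<^sub>L 'u) \<Rightarrow> real set \<Rightarrow> (real \<Rightarrow> 'v) \<Rightarrow> (real \<Rightarrow> 'v) \<Rightarrow> bool" where
  "strong_solution j B1 B1s J z zt \<longleftrightarrow>
     continuous_on J zt \<and>
     (\<forall>s\<in>J. (z has_vector_derivative zt s) (at s within J)) \<and>
     (\<exists>ztt. continuous_on J ztt \<and>
        (\<forall>s\<in>J. ((\<lambda>r. j (zt r)) has_vector_derivative ztt s) (at s within J)) \<and>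
        (\<forall>s\<in>J. pivot j (ztt s) + ext_A (z s) + B1 s (B1s s (zt s)) = 0))"

text \<open>\<open>w\<close> is the limit in \<open>C(J; V) \<inter> C\<^sup>1(J; H)\<close> of the strong solutions \<open>z k\<close>.\<close>

definition strong_approx ::
    "('v::real_inner \<Rightarrow>\<^sub>L 'h::real_inner) \<Rightarrow> (real \<Rightarrow> 'u::real_inner \<Rightarrow>\<^sub>L ('v \<Rightarrow>\<^sub>L real)) \<Rightarrow>
     (real \<Rightarrow> 'v \<Rightarrow>\<^sub>L 'u) \<Rightarrow> real set \<Rightarrow> (nat \<Rightarrow> real \<Rightarrow> 'v) \<Rightarrow> (nat \<Rightarrow> real \<Rightarrow> 'v) \<Rightarrow>
     (real \<Rightarrow> 'v) \<Rightarrow> (real \<Rightarrow> 'h) \<Rightarrow> bool" where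
  "strong_approx j B1 B1s J z zt w wt \<longleftrightarrow>
     (\<forall>k. strong_solution j B1 B1s J (z k) (zt k)) \<and>
     uniform_limit J z w sequentially \<and>
     uniform_limit J (\<lambda>k s. j (zt k s)) wt sequentially"

definition mild_damped ::
    "('v::real_inner \<Rightarrow>\<^sub>L 'h::real_inner) \<Rightarrow> (real \<Rightarrow> 'u::real_inner \<Rightarrow>\<^sub>L ('v \<Rightarrow>\<^sub>L real)) \<Rightarrow>
     (real \<Rightarrow> 'v \<Rightarrow>\<^sub>L 'u) \<Rightarrow> real set \<Rightarrow> (real \<Rightarrow> 'v) \<Rightarrow> (real \<Rightarrow> 'h) \<Rightarrow> bool" where
  "mild_damped j B1 B1s I w wt \<longleftrightarrow>
     (\<forall>a b. a < b \<and> {a..b} \<subseteq> I \<longrightarrow> (\<exists>z zt. strong_approx j B1 B1s {a..b} z zt w wt))"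

definition L2_limit ::
    "real set \<Rightarrow> (nat \<Rightarrow> real \<Rightarrow> 'u::real_inner) \<Rightarrow> (real \<Rightarrow> 'u) \<Rightarrow> bool" where
  "L2_limit J f g \<longleftrightarrow>
     set_borel_measurable lborel J g \<and>
     (\<forall>k. set_integrable lborel J (\<lambda>s. (norm (f k s - g s))\<^sup>2)) \<and>
     (\<lambda>k. LINT s:J|lborel. (norm (f k s - g s))\<^sup>2) \<longlonglongrightarrow> 0"

text \<open>
  \<open>g\<close> is \<open>B\<^sub>1\<^sup>* w\<^sub>t\<close>.  As \<open>w\<^sub>t\<close> is only \<open>H\<close>-valued, this is the \<open>L\<^sup>2\<close> limit
  of \<open>B\<^sub>1\<^sup>* z\<^sub>t\<close> along approximating strong solutions, and is determined almost everywhere.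
\<close>

definition damping_trace ::
    "('v::real_inner \<Rightarrow>\<^sub>L 'h::real_inner) \<Rightarrow> (real \<Rightarrow> 'u::real_inner \<Rightarrow>\<^sub>L ('v \<Rightarrow>\<^sub>L real)) \<Rightarrow>
     (real \<Rightarrow> 'v \<Rightarrow>\<^sub>L 'u) \<Rightarrow> real set \<Rightarrow> (real \<Rightarrow> 'v) \<Rightarrow> (real \<Rightarrow> 'h) \<Rightarrow> (real \<Rightarrow> 'u) \<Rightarrow> bool" where
  "damping_trace j B1 B1s I w wt g \<longleftrightarrow>
     (\<forall>a b. a < b \<and> {a..b} \<subseteq> I \<longrightarrow>
        (\<exists>z zt. strong_approx j B1 B1s {a..b} z zt w wt \<and>
                L2_limit {a..b} (\<lambda>k s. B1s s (zt k s)) g))"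

text \<open>
  Weak solutions of the undelayed problem on \<open>(a, b)\<close>.  They are continuous up to \<open>b\<close>
  (where the energy is evaluated), but approximated only on compact subintervals of \<open>[a, b)\<close>.
\<close>

definition damped_weak_solution ::
    "('v::real_inner \<Rightarrow>\<^sub>L 'h::real_inner) \<Rightarrow> (real \<Rightarrow> 'u::real_inner \<Rightarrow>\<^sub>L ('v \<Rightarrow>\<^sub>L real)) \<Rightarrow>
     (real \<Rightarrow> 'v \<Rightarrow>\<^sub>L 'u) \<Rightarrow> real \<Rightarrow> real \<Rightarrow> 'v \<Rightarrow> 'h \<Rightarrow> (real \<Rightarrow> 'v) \<Rightarrow> (real \<Rightarrow> 'h) \<Rightarrow> bool" where
  "damped_weak_solution j B1 B1s a b w0 w1 w wt \<longleftrightarrow>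
     finite_energy j {a..b} w wt \<and> mild_damped j B1 B1s {a..<b} w wt \<and>
     w a = w0 \<and> wt a = w1"

text \<open>
  Solutions of the delayed problem.  On \<open>[t\<^sub>2\<^sub>n, t\<^sub>2\<^sub>n\<^sub>+\<^sub>1)\<close> the delay term vanishes with \<open>B\<^sub>2\<close>; on
  \<open>[t\<^sub>2\<^sub>n\<^sub>+\<^sub>1, t\<^sub>2\<^sub>n\<^sub>+\<^sub>2)\<close> the term with \<open>B\<^sub>1\<close> vanishes and the equation is an identity in \<open>V'\<close>.
\<close>

definition delayed_solution ::
    "('v::real_inner \<Rightarrow>\<^sub>L 'h::real_inner) \<Rightarrow>
     (real \<Rightarrow> 'u1::real_inner \<Rightarrow>\<^sub>L ('v \<Rightarrow>\<^sub>L real)) \<Rightarrow> (real \<Rightarrow> 'v \<Rightarrow>\<^sub>L 'u1) \<Rightarrow>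
     (real \<Rightarrow> 'u2::real_inner \<Rightarrow>\<^sub>L 'h) \<Rightarrow> (real \<Rightarrow> 'h \<Rightarrow>\<^sub>L 'u2) \<Rightarrow>
     real \<Rightarrow> (nat \<Rightarrow> real) \<Rightarrow> 'v \<Rightarrow> 'h \<Rightarrow> (real \<Rightarrow> 'v) \<Rightarrow> (real \<Rightarrow> 'h) \<Rightarrow> bool" where
  "delayed_solution j B1 B1s B2 B2s \<tau> t u0 u1 u ut \<longleftrightarrow>
     finite_energy j {0..} u ut \<and> u 0 = u0 \<and> ut 0 = u1 \<and>
     (\<forall>n. mild_damped j B1 B1s {t (2*n)..<t (2*n+1)} u ut) \<and>
     (\<forall>n. \<forall>s\<in>{t (2*n+1)..<t (2*n+2)}.
        ((\<lambda>r. pivot j (ut r)) has_vector_derivative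
           - (ext_A (u s) + pivot j (B2 s (B2s s (ut (s - \<tau>))))))
        (at s within {t (2*n+1)..<t (2*n+2)}))"

end

theory Submission
  imports Defs
begin

text \<open>
  On \<open>I\<^sub>2\<^sub>n\<close> the energy is dissipated exactly by \<open>\<integral> \<parallel>B\<^sub>1\<^sup>* u\<^sub>t\<parallel>\<^sup>2\<close>, so observability gives
  \<open>E(t\<^sub>2\<^sub>n\<^sub>+\<^sub>1) \<le> d/(d+1) E(t\<^sub>2\<^sub>n)\<close>. On \<open>I\<^sub>2\<^sub>n\<^sub>+\<^sub>1\<close> the delayed velocity is read off \<open>I\<^sub>2\<^sub>n\<close>, because
  \<open>T~ \<le> \<tau> \<le> T*\<close>; hence \<open>E' \<le> C M (E + E(t\<^sub>2\<^sub>n))\<close>, and Gronwall's inequality shows that the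
  energy is multiplied by at most \<open>e\<^bsup>C M T~\<^esup> (d/(d+1) + 1) - 1\<close> over one period. This factor is
  bounded away from \<open>1\<close>, uniformly in \<open>n\<close>.
\<close>

subsection \<open>Adjoints and strong solutions\<close>

text \<open>Solutions have finite energy only: \<open>ut\<close> takes its values in
  \<open>H\<close>, so the equation cannot be tested with it, and \<open>B1s s (ut s)\<close> has no
  pointwise meaning. The mild notion supplies strong solutions separately for each compact
  subinterval, whereas the observability hypothesis asks for one trace \<open>g\<close> on the whole
  half-open interval. A diagonal sequence of strong solutions provides it. Both directions of the
  energy identity for this trace are used, because \<open>d\<close> carries no sign and a negative
  value is excluded through the equality, except for vanishing energy. The fraction
  \<open>d / (d + 1)\<close> results from solving \<open>E_b \<le> d * (E_a - E_b)\<close> for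
  \<open>E_b\<close>. The summands \<open>+ 1\<close> and \<open>- 1\<close> of the contraction
  factor come from running Gronwall's inequality on \<open>E + E_a\<close>, where the constant
  \<open>E_a\<close> dominates the delayed energy, and from subtracting \<open>E_a\<close> at the
  end.\<close>

lemma is_adjoint_dual_norm_le:
  assumes "is_adjoint_dual B Bs"
  shows "norm Bs \<le> norm B"
proof (rule norm_blinfun_bound)
  fix v
  have "norm (Bs v) * norm (Bs v) = B (Bs v) v"
    using assms by (simp add: is_adjoint_dual_def dot_square_norm power2_eq_square)
  also have "\<dots> \<le> norm (B (Bs v)) * norm v"
    using norm_blinfun[of "B (Bs v)" v] by simp
  also have "\<dots> \<le> (norm B * norm v) * norm (Bs v)"
    using mult_right_mono[OF norm_blinfun[of B "Bs v"], of "norm v"] by (simp add: mult_ac)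
  finally show "norm (Bs v) \<le> norm B * norm v"
    by (cases "norm (Bs v) = 0") auto
qed simp

lemma is_adjoint_norm_le:
  assumes "is_adjoint B Bs"
  shows "norm Bs \<le> norm B"
proof (rule norm_blinfun_bound)
  fix v
  have "norm (Bs v) * norm (Bs v) = B (Bs v) \<bullet> v"
    using assms by (simp add: is_adjoint_def dot_square_norm power2_eq_square)
  also have "\<dots> \<le> norm (B (Bs v)) * norm v"
    by (rule norm_cauchy_schwarz)
  also have "\<dots> \<le> (norm B * norm v) * norm (Bs v)"
    using mult_right_mono[OF norm_blinfun[of B "Bs v"], of "norm v"] by (simp add: mult_ac)
  finally show "norm (Bs v) \<le> norm B * norm v"
    by (cases "norm (Bs v) = 0") auto
qed simp

text \<open>Serves to transfer continuity between operator families that dominate one another: to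
  adjoints with \<open>K = 1\<close>, and from \<open>H\<close>-valued to \<open>V'\<close>-valued
  operators with \<open>K = norm j\<close>.\<close>

lemma continuous_on_dist_le:
  fixes f :: "'a::topological_space \<Rightarrow> 'b::metric_space" and g :: "'a \<Rightarrow> 'c::metric_space"
  assumes "continuous_on S f" and "\<And>x y. \<lbrakk>x \<in> S; y \<in> S\<rbrakk> \<Longrightarrow> dist (g x) (g y) \<le> K * dist (f x) (f y)"
  shows "continuous_on S g"
  unfolding continuous_on_def
proof (intro ballI)
  fix x assume x: "x \<in> S"
  have "((\<lambda>y. K * dist (f y) (f x)) \<longlongrightarrow> K * dist (f x) (f x)) (at x within S)"
    using assms(1) x by (intro tendsto_intros) (auto simp: continuous_on_def)
  then have lim: "((\<lambda>y. K * dist (f y) (f x)) \<longlongrightarrow> 0) (at x within S)"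
    by simp
  have ev: "\<forall>\<^sub>F y in at x within S. dist (g y) (g x) \<le> K * dist (f y) (f x)"
    using assms(2) x by (auto simp: eventually_at_filter)
  have "((\<lambda>y. dist (g y) (g x)) \<longlongrightarrow> 0) (at x within S)"
    by (rule tendsto_sandwich[OF _ ev tendsto_const lim]) simp
  then show "(g \<longlongrightarrow> g x) (at x within S)"
    by (rule tendsto_dist_iff[THEN iffD2])
qed

text \<open>Taking adjoints is additive and does not increase the norm, so \<open>Bs\<close> is a
  Lipschitz function of \<open>B\<close>.\<close>

lemma continuous_on_adjoint_dual:
  fixes B :: "real \<Rightarrow> 'u::real_inner \<Rightarrow>\<^sub>L ('v::real_inner \<Rightarrow>\<^sub>L real)"
  assumes "\<And>s. is_adjoint_dual (B s) (Bs s)" and "continuous_on I B"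
  shows "continuous_on I Bs"
proof (rule continuous_on_dist_le[OF assms(2), of _ 1])
  fix s r
  have "is_adjoint_dual (B s - B r) (Bs s - Bs r)"
    using assms(1) by (simp add: is_adjoint_dual_def blinfun.diff_left inner_diff_right)
  from is_adjoint_dual_norm_le[OF this] show "dist (Bs s) (Bs r) \<le> 1 * dist (B s) (B r)"
    by (simp add: dist_norm)
qed

lemma continuous_on_adjoint:
  fixes B :: "real \<Rightarrow> 'u::real_inner \<Rightarrow>\<^sub>L 'h::real_inner"
  assumes "\<And>s. is_adjoint (B s) (Bs s)" and "continuous_on I B"
  shows "continuous_on I Bs"
proof (rule continuous_on_dist_le[OF assms(2), of _ 1])
  fix s r
  have "is_adjoint (B s - B r) (Bs s - Bs r)"
    using assms(1) by (simp add: is_adjoint_def blinfun.diff_left inner_diff_right inner_diff_left)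
  from is_adjoint_norm_le[OF this] show "dist (Bs s) (Bs r) \<le> 1 * dist (B s) (B r)"
    by (simp add: dist_norm)
qed

lemma pivot_apply [simp]: "blinfun_apply (pivot j h) v = h \<bullet> j v"
  by (simp add: pivot_def inner_commute)

lemma ext_A_apply [simp]: "blinfun_apply (ext_A u) v = u \<bullet> v"
  by (simp add: ext_A_def inner_commute)

lemma bounded_linear_ext_A: "bounded_linear (ext_A :: 'v::real_inner \<Rightarrow> _)"
  unfolding ext_A_def by (rule bounded_linear_blinfun_inner_left) 

lemma bounded_linear_pivot: "bounded_linear (pivot j)"
  unfolding pivot_def
  by (rule bounded_linear_compose[OF bounded_bilinear.bounded_linear_left[OF bounded_bilinear_blinfun_compose, of j]])
    (rule bounded_linear_blinfun_inner_left)

text \<open>Here \<open>B1\<close> is the \<open>H\<close>-valued \<open>F\<close> followed by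
  \<open>pivot j\<close>, an embedding of norm at most \<open>norm j\<close>.\<close>

lemma continuous_on_B1_smooth:
  assumes "B1_smooth_bounded j B1 a b"
  shows "continuous_on {a..<b} B1"
proof -
  obtain F F' where F: "\<And>s. s\<in>{a..b} \<Longrightarrow> (F has_vector_derivative F' s) (at s within {a..b})"
    and B1: "\<And>s x. s\<in>{a..<b} \<Longrightarrow> B1 s x = pivot j (blinfun_apply (F s) x)"
    using assms unfolding B1_smooth_bounded_def C1_on_def by blast
  have "continuous_on {a..b} F"
    by (rule continuous_on_vector_derivative[OF F])
  then have "continuous_on {a..<b} F"
    by (rule continuous_on_subset) auto
  then show ?thesis
  proof (rule continuous_on_dist_le[of _ _ _ "norm j"])
    fix s r assume sr: "s \<in> {a..<b}" "r \<in> {a..<b}"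
    have "norm (B1 s - B1 r) \<le> norm j * norm (F s - F r)"
    proof (rule norm_blinfun_bound)
      fix x
      have eq: "(B1 s - B1 r) x = pivot j ((F s - F r) x)"
        using sr by (auto intro!: blinfun_eqI simp: B1 blinfun.diff_left inner_diff_left)
      have "norm (pivot j ((F s - F r) x)) \<le> norm j * norm ((F s - F r) x)"
      proof (rule norm_blinfun_bound)
        fix v
        have "norm ((F s - F r) x \<bullet> j v) \<le> norm ((F s - F r) x) * norm (j v)"
          by (simp add: Cauchy_Schwarz_ineq2)
        also have "\<dots> \<le> norm ((F s - F r) x) * (norm j * norm v)"
          by (simp add: mult_left_mono norm_blinfun)
        finally show "norm (pivot j ((F s - F r) x) v) \<le> norm j * norm ((F s - F r) x) * norm v"
          by (simp add: mult_ac)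
      qed simp
      also have "\<dots> \<le> norm j * (norm (F s - F r) * norm x)"
        by (simp add: mult_left_mono norm_blinfun)
      finally show "norm ((B1 s - B1 r) x) \<le> norm j * norm (F s - F r) * norm x"
        by (simp add: eq mult_ac)
    qed simp
    then show "dist (B1 s) (B1 r) \<le> norm j * dist (F s) (F r)"
      by (simp add: dist_norm)
  qed
qed

lemma continuous_on_B1_scaled:
  assumes "B1_scaled B1 a b"
  shows "continuous_on {a..<b} B1"
proof -
  obtain \<beta> K where "continuous_on {a..<b} \<beta>" and B1: "\<And>s. s\<in>{a..<b} \<Longrightarrow> B1 s = sqrt (\<beta> s) *\<^sub>R K"
    using assms unfolding B1_scaled_def by blast
  then have "continuous_on {a..<b} (\<lambda>s. sqrt (\<beta> s) *\<^sub>R K)"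
    by (intro continuous_intros)
  then show ?thesis
    by (rule continuous_on_cong[THEN iffD1, rotated -1]) (simp_all add: B1)
qed

section \<open>Energy of strong solutions\<close>

lemma energy_nonneg: "0 \<le> energy w wt s"
  by (simp add: energy_def)

lemma strong_solution_subset:
  assumes "strong_solution j B1 B1s J z zt" and "J' \<subseteq> J"
  shows "strong_solution j B1 B1s J' z zt"
  using assms unfolding strong_solution_def
  by (meson continuous_on_subset has_vector_derivative_within_subset subsetD)

text \<open>The equation is linear. For two approximants of the same weak solution, this turns the
  energy identity into an estimate of the \<open>L^2\<close> distance of their damping
  terms.\<close>

lemma strong_solution_diff:
  assumes "strong_solution j B1 B1s J z zt" and "strong_solution j B1 B1s J y yt"
  shows "strong_solution j B1 B1s J (\<lambda>s. z s - y s) (\<lambda>s. zt s - yt s)"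
proof -
  obtain ztt where ztt: "continuous_on J ztt" 
      "\<forall>s\<in>J. ((\<lambda>r. j (zt r)) has_vector_derivative ztt s) (at s within J)"
      "\<forall>s\<in>J. pivot j (ztt s) + ext_A (z s) + B1 s (B1s s (zt s)) = 0"
    using assms(1) unfolding strong_solution_def by blast
  obtain ytt where ytt: "continuous_on J ytt" 
      "\<forall>s\<in>J. ((\<lambda>r. j (yt r)) has_vector_derivative ytt s) (at s within J)"
      "\<forall>s\<in>J. pivot j (ytt s) + ext_A (y s) + B1 s (B1s s (yt s)) = 0"
    using assms(2) unfolding strong_solution_def by blast
  have eq: "pivot j (ztt s - ytt s) + ext_A (z s - y s) + B1 s (B1s s (zt s - yt s)) = 0" 
    if "s \<in> J" for s
  proof -
    have "pivot j (ztt s - ytt s) + ext_A (z s - y s) + B1 s (B1s s (zt s - yt s))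
      = (pivot j (ztt s) + ext_A (z s) + B1 s (B1s s (zt s))) -
        (pivot j (ytt s) + ext_A (y s) + B1 s (B1s s (yt s)))"
      by (simp add: blinfun.diff_right linear_diff bounded_linear.linear[OF bounded_linear_pivot]
          bounded_linear.linear[OF bounded_linear_ext_A])
    then show ?thesis
      using ztt(3) ytt(3) that by simp
  qed
  show ?thesis
    unfolding strong_solution_def
  proof (intro conjI exI[of _ "\<lambda>s. ztt s - ytt s"] ballI)
    show "continuous_on J (\<lambda>s. zt s - yt s)"
      using assms by (intro continuous_intros) (auto simp: strong_solution_def)
    show "((\<lambda>s. z s - y s) has_vector_derivative zt s - yt s) (at s within J)" if "s \<in> J" for s
      using assms that by (intro has_vector_derivative_diff) (auto simp: strong_solution_def)
    show "continuous_on J (\<lambda>s. ztt s - ytt s)"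
      using ztt ytt by (intro continuous_intros)
    show "((\<lambda>r. j (zt r - yt r)) has_vector_derivative ztt s - ytt s) (at s within J)"
      if "s \<in> J" for s
      using ztt ytt that by (auto simp: blinfun.diff_right intro!: has_vector_derivative_diff)
  qed (rule eq)
qed

lemma has_vector_derivative_half_norm_power2:
  fixes x :: "real \<Rightarrow> 'a::real_inner"
  assumes "(x has_vector_derivative x') (at s within J)"
  shows "((\<lambda>r. (1/2) * (norm (x r))\<^sup>2) has_real_derivative x s \<bullet> x') (at s within J)"
  unfolding power2_norm_eq_inner has_field_derivative_def
  by (rule has_derivative_eq_rhs)
    (auto intro!: derivative_eq_intros assms[unfolded has_vector_derivative_def]
      simp: inner_commute fun_eq_iff)

lemma energy_has_derivative:
  assumes "(w has_vector_derivative w') (at s within J)"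
    and "(wt has_vector_derivative wt') (at s within J)"
  shows "(energy w wt has_real_derivative w s \<bullet> w' + wt s \<bullet> wt') (at s within J)"
  using DERIV_add[OF assms[THEN has_vector_derivative_half_norm_power2]]
  by (simp add: energy_def[abs_def] distrib_left)

text \<open>The velocity \<open>zt s\<close> lies in \<open>V\<close> and may be used as a test
  vector; the adjoint then turns the damping term into a square. This square equals an expression
  that is continuous in \<open>s\<close>, namely minus the derivative of the energy, so the
  fundamental theorem yields integrability together with the value.\<close>

lemma strong_solution_energy:
  assumes sol: "strong_solution j B1 B1s {a..b} z zt" and adj: "\<And>s. is_adjoint_dual (B1 s) (B1s s)"
    and "a \<le> b"
  shows "has_bochner_integral lborel (\<lambda>s. indicator {a..b} s * (norm (B1s s (zt s)))\<^sup>2)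
           (energy z (\<lambda>s. j (zt s)) a - energy z (\<lambda>s. j (zt s)) b)"
proof -
  let ?E = "energy z (\<lambda>s. j (zt s))"
  obtain ztt where cont: "continuous_on {a..b} ztt"
      and d2: "\<And>s. s\<in>{a..b} \<Longrightarrow> ((\<lambda>r. j (zt r)) has_vector_derivative ztt s) (at s within {a..b})"
      and eq: "\<And>s. s\<in>{a..b} \<Longrightarrow> pivot j (ztt s) + ext_A (z s) + B1 s (B1s s (zt s)) = 0"
    using sol unfolding strong_solution_def by blast
  have czt: "continuous_on {a..b} zt" 
    and d1: "\<And>s. s\<in>{a..b} \<Longrightarrow> (z has_vector_derivative zt s) (at s within {a..b})"
    using sol by (auto simp: strong_solution_def)
  have cz: "continuous_on {a..b} z"
    by (rule continuous_on_vector_derivative[OF d1])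
  have test: "(norm (B1s s (zt s)))\<^sup>2 = - (z s \<bullet> zt s + j (zt s) \<bullet> ztt s)" if "s \<in> {a..b}" for s
  proof -
    have "blinfun_apply (pivot j (ztt s) + ext_A (z s) + B1 s (B1s s (zt s))) (zt s) = 0"
      using eq[OF that] by simp
    then show ?thesis
      using adj[of s] by (simp add: blinfun.add_left is_adjoint_dual_def dot_square_norm inner_commute)
  qed
  have "has_bochner_integral lborel
      (\<lambda>s. indicator {a..b} s *\<^sub>R - (z s \<bullet> zt s + j (zt s) \<bullet> ztt s)) (- ?E b - - ?E a)"
  proof (rule has_bochner_integral_FTC_Icc[OF \<open>a \<le> b\<close>])
    show "((\<lambda>s. - ?E s) has_vector_derivative - (z s \<bullet> zt s + j (zt s) \<bullet> ztt s)) (at s within {a..b})"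
      if "a \<le> s" "s \<le> b" for s
      using energy_has_derivative[OF d1 d2, of s] that
      by (intro has_vector_derivative_minus) (simp add: has_real_derivative_iff_has_vector_derivative)
    show "continuous_on {a..b} (\<lambda>s. - (z s \<bullet> zt s + j (zt s) \<bullet> ztt s))"
      using cz czt cont by (intro continuous_intros)
  qed
  then show ?thesis
    by (rule has_bochner_integral_cong[THEN iffD1, rotated -1])
       (auto simp: test split: split_indicator)
qed

lemma strong_solution_energy_decreasing:
  assumes "strong_solution j B1 B1s {a..b} z zt" and "\<And>s. is_adjoint_dual (B1 s) (B1s s)"
    and "a \<le> r" "r \<le> s" "s \<le> b"
  shows "energy z (\<lambda>s. j (zt s)) s \<le> energy z (\<lambda>s. j (zt s)) r"
proof -
  have "strong_solution j B1 B1s {r..s} z zt"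
    using assms by (intro strong_solution_subset[OF assms(1)]) auto
  from strong_solution_energy[OF this assms(2) \<open>r \<le> s\<close>] have
    "0 \<le> energy z (\<lambda>s. j (zt s)) r - energy z (\<lambda>s. j (zt s)) s"
    by (metis (no_types, lifting) has_bochner_integral_integral_eq Bochner_Integration.integral_nonneg indicator_pos_le mult_nonneg_nonneg zero_le_power2)
  then show ?thesis
    by simp
qed

subsection \<open>Energy identity for the forced equation\<close>

lemma norm_blinfun_inner_left [simp]: "norm (blinfun_inner_left x) = norm x"
proof (rule antisym)
  show "norm (blinfun_inner_left x) \<le> norm x"
    by (rule norm_blinfun_bound) (auto simp: Cauchy_Schwarz_ineq2 mult.commute)
  have "norm x * norm x \<le> norm (blinfun_inner_left x) * norm x"
    using norm_blinfun[of "blinfun_inner_left x" x] by (simp add: dot_square_norm power2_eq_square)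
  then show "norm x \<le> norm (blinfun_inner_left x)"
    by (cases "norm x = 0") auto
qed

lemma linear_blinfun_inner_left: "linear blinfun_inner_left"
  by (rule bounded_linear.linear[OF bounded_linear_blinfun_inner_left])

text \<open>The isometric image of a complete space is complete, hence closed. This is what brings
  limits computed in the dual back to the space.\<close>

lemma closed_range_blinfun_inner_left:
  "closed (range (blinfun_inner_left :: 'a::{real_inner, complete_space} \<Rightarrow> _))"
  by (rule complete_imp_closed, rule complete_isometric_image[where e=1])
    (auto simp: bounded_linear_blinfun_inner_left complete_UNIV)

text \<open>The isometry carries the telescoping series into the dual, where absolute summability
  gives convergence; the Cauchy property is then pulled back.\<close>

lemma convergent_if_summable_norm_diff:
  fixes x :: "nat \<Rightarrow> 'a::{real_inner, complete_space}"
  assumes "summable (\<lambda>k. norm (x k - x (Suc k)))"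
  shows "convergent x"
proof -
  have eq: "norm (x k - x (Suc k)) = norm (blinfun_inner_left (x (Suc k)) - blinfun_inner_left (x k))" for k
    unfolding linear_diff[OF linear_blinfun_inner_left, symmetric] by (simp add: norm_minus_commute)
  have "summable (\<lambda>k. blinfun_inner_left (x (Suc k)) - blinfun_inner_left (x k))"
    using assms unfolding eq by (rule summable_norm_cancel)
  then have "convergent (\<lambda>k. blinfun_inner_left (x k))"
    unfolding summable_iff_convergent sum_lessThan_telescope[of "\<lambda>k. blinfun_inner_left (x k)"]
    by (simp add: convergent_diff_const_right_iff)
  then have "Cauchy (blinfun_inner_left \<circ> x)"
    unfolding o_def by (rule convergent_Cauchy)
  then have "Cauchy x"
    by (rule cauchy_isometric[where e=1, OF zero_less_one subspace_UNIV
          bounded_linear_blinfun_inner_left, rotated 2]) simp_all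
  then show ?thesis
    by (rule Cauchy_convergent)
qed

text \<open>
  The sort \<open>{real_inner, complete_space}\<close> is not below \<open>banach\<close>, so the library's integral of
  continuous functions is not available. The primitive is computed in the dual space, and it stays
  in the closed range of the Riesz embedding.
\<close>

lemma antiderivative_exists:
  fixes f :: "real \<Rightarrow> 'a::{real_inner, complete_space}"
  assumes f: "continuous_on {c..e} f"
  obtains F where "\<And>s. s \<in> {c..e} \<Longrightarrow> (F has_vector_derivative f s) (at s within {c..e})"
proof -
  let ?i = "blinfun_inner_left :: 'a \<Rightarrow> _"
  have i: "continuous_on {c..e} (\<lambda>s. ?i (f s))"
    by (rule bounded_linear.continuous_on[OF bounded_linear_blinfun_inner_left f])
  define G where "G s = integral {c..s} (\<lambda>s. ?i (f s))" for s
  have dG: "(G has_vector_derivative ?i (f s)) (at s within {c..e})" if "s \<in> {c..e}" for s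
    unfolding G_def using integral_has_vector_derivative[OF i that] .
  \<comment> \<open>Every Riemann sum of \<open>?i (f s)\<close> is the image of a finite sum in the
    space, so the integral lies in the closure of the range.\<close>
  have "G s \<in> range ?i" if "s \<in> {c..e}" for s
  proof -
    have "(\<lambda>s. ?i (f s)) integrable_on {c..s}"
      using that by (intro integrable_continuous_real continuous_on_subset[OF i]) auto
    then have int: "((\<lambda>s. ?i (f s)) has_integral G s) {c..s}"
      unfolding G_def by (rule integrable_integral)
    have "G s \<in> closure (range ?i)"
      unfolding closure_approachable
    proof (intro allI impI)
      fix \<epsilon> :: real assume "0 < \<epsilon>"
      obtain \<gamma> where "gauge \<gamma>" and \<gamma>: "\<And>\<D>. \<lbrakk>\<D> tagged_division_of {c..s}; \<gamma> fine \<D>\<rbrakk> \<Longrightarrow>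
          norm ((\<Sum>(x,k)\<in>\<D>. measure lborel k *\<^sub>R ?i (f x)) - G s) < \<epsilon>"
        using int[unfolded has_integral_real, rule_format, OF \<open>0 < \<epsilon>\<close>] by metis
      obtain \<D> where \<D>: "\<D> tagged_division_of {c..s}" "\<gamma> fine \<D>"
        using fine_division_exists_real[OF \<open>gauge \<gamma>\<close>] by blast
      have "(\<Sum>(x,k)\<in>\<D>. measure lborel k *\<^sub>R ?i (f x)) = ?i (\<Sum>(x,k)\<in>\<D>. measure lborel k *\<^sub>R f x)"
        by (simp add: linear_sum[OF linear_blinfun_inner_left]
            linear_scale[OF linear_blinfun_inner_left] split_def)
      then show "\<exists>y\<in>range ?i. dist y (G s) < \<epsilon>"
        using \<gamma>[OF \<D>] by (auto simp: dist_norm)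
    qed
    then show ?thesis
      unfolding closure_closed[OF closed_range_blinfun_inner_left] .
  qed
  then have "\<forall>s\<in>{c..e}. \<exists>x. G s = ?i x"
    by blast
  then obtain F where F: "\<And>s. s \<in> {c..e} \<Longrightarrow> G s = ?i (F s)"
    by metis
  show thesis
  proof (rule that[of F])
    fix s assume s: "s \<in> {c..e}"
    \<comment> \<open>The isometry preserves the norm of the first-order remainder, so
      differentiability passes from \<open>G\<close> to \<open>F\<close>.\<close>
    have eq: "norm (F r - F s - (r - s) *\<^sub>R f s) = norm (G r - G s - (r - s) *\<^sub>R ?i (f s))"
      if "r \<in> {c..e}" for r
      unfolding F[OF that] F[OF s] linear_diff[OF linear_blinfun_inner_left, symmetric]
        linear_scale[OF linear_blinfun_inner_left, symmetric] by simp
    have "((\<lambda>r. norm (G r - G s - (r - s) *\<^sub>R ?i (f s)) / norm (r - s)) \<longlongrightarrow> 0) (at s within {c..e})"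
      using dG[OF s] by (simp add: has_vector_derivative_def has_derivative_iff_norm)
    then have "((\<lambda>r. norm (F r - F s - (r - s) *\<^sub>R f s) / norm (r - s)) \<longlongrightarrow> 0) (at s within {c..e})"
      by (rule Lim_transform_eventually) (auto simp: eventually_at_filter eq)
    then show "(F has_vector_derivative f s) (at s within {c..e})"
      by (simp add: has_vector_derivative_def has_derivative_iff_norm bounded_linear_scaleR_left)
  qed
qed

text \<open>The mean value inequality bounds the error at \<open>s\<close> by the oscillation of
  \<open>p\<close> on \<open>{s..s + h k}\<close>, which uniform continuity makes small
  independently of \<open>s\<close>. The condition \<open>h k \<le> e - r\<close> keeps
  \<open>s + h k\<close> inside \<open>{c..e}\<close>.\<close>

lemma uniform_limit_difference_quotient:
  fixes P p :: "real \<Rightarrow> 'a::real_normed_vector"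
  assumes p: "continuous_on {c..e} p"
    and P: "\<And>s. s \<in> {c..e} \<Longrightarrow> (P has_vector_derivative p s) (at s within {c..e})"
    and h: "h \<longlonglongrightarrow> 0" and h': "\<And>k. 0 < h k \<and> h k \<le> e - r"
  shows "uniform_limit {c..r} (\<lambda>k s. (1 / h k) *\<^sub>R (P (s + h k) - P s)) p sequentially"
proof (rule uniform_limitI)
  fix \<epsilon> :: real assume "0 < \<epsilon>"
  have "uniformly_continuous_on {c..e} p"
    using p by (rule compact_uniformly_continuous) simp
  with \<open>0 < \<epsilon>\<close> obtain \<delta> where "0 < \<delta>"
    and \<delta>: "\<And>x y. \<lbrakk>x \<in> {c..e}; y \<in> {c..e}; dist y x < \<delta>\<rbrakk> \<Longrightarrow> dist (p y) (p x) < \<epsilon> / 2"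
    unfolding uniformly_continuous_on_def by (metis half_gt_zero)
  have "\<forall>\<^sub>F k in sequentially. h k < \<delta>"
    using order_tendstoD(2)[OF h \<open>0 < \<delta>\<close>] .
  then show "\<forall>\<^sub>F k in sequentially. \<forall>s\<in>{c..r}. dist ((1 / h k) *\<^sub>R (P (s + h k) - P s)) (p s) < \<epsilon>"
  proof eventually_elim
    case (elim k)
    show ?case
    proof
      fix s assume s: "s \<in> {c..r}"
      have sub: "{s..s + h k} \<subseteq> {c..e}"
        using s h'[of k] by auto
      have "norm (P (s + h k) - P s - (s + h k - s) *\<^sub>R p s) \<le> norm (s + h k - s) * (\<epsilon> / 2)"
      proof (rule vector_differentiable_bound_linearization)
        show "(P has_vector_derivative p x) (at x within {s..s + h k})" if "x \<in> {s..s + h k}" for x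
          using has_vector_derivative_within_subset[OF P sub] that sub by auto
        show "norm (p x - p s) \<le> \<epsilon> / 2" if "x \<in> {s..s + h k}" for x
        proof -
          have "s \<in> {c..e}" "x \<in> {c..e}" "dist x s < \<delta>"
            using that sub elim h'[of k] s by (auto simp: dist_real_def)
          then show ?thesis
            using \<delta>[of s x] by (simp add: dist_norm)
        qed
        show "closed_segment s (s + h k) \<subseteq> {s..s + h k}" "s \<in> {s..s + h k}"
          using h'[of k] by (auto simp: closed_segment_eq_real_ivl)
      qed
      then have le: "norm (P (s + h k) - P s - h k *\<^sub>R p s) \<le> h k * (\<epsilon> / 2)"
        using h'[of k] by simp
      have "(1 / h k) *\<^sub>R (P (s + h k) - P s) - p s = (1 / h k) *\<^sub>R (P (s + h k) - P s - h k *\<^sub>R p s)"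
        using h'[of k] by (simp add: scaleR_right_diff_distrib)
      then have "dist ((1 / h k) *\<^sub>R (P (s + h k) - P s)) (p s)
          = (1 / h k) * norm (P (s + h k) - P s - h k *\<^sub>R p s)"
        using h'[of k] by (simp add: dist_norm)
      also have "\<dots> \<le> (1 / h k) * (h k * (\<epsilon> / 2))"
        using le h'[of k] by (intro mult_left_mono) auto
      also have "\<dots> < \<epsilon>"
        using h'[of k] \<open>0 < \<epsilon>\<close> by simp
      finally show "dist ((1 / h k) *\<^sub>R (P (s + h k) - P s)) (p s) < \<epsilon>" .
    qed
  qed
qed

lemma has_vector_derivative_difference_quotient:
  fixes P p :: "real \<Rightarrow> 'a::real_normed_vector"
  assumes P: "\<And>s. s \<in> {c..e} \<Longrightarrow> (P has_vector_derivative p s) (at s within {c..e})"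
    and "0 \<le> h" "r + h \<le> e" "s \<in> {c..r}"
  shows "((\<lambda>s. (1 / h) *\<^sub>R (P (s + h) - P s)) has_vector_derivative (1 / h) *\<^sub>R (p (s + h) - p s))
           (at s within {c..r})"
proof -
  have sub: "(\<lambda>s. s + h) ` {c..r} \<subseteq> {c..e}" "{c..r} \<subseteq> {c..e}"
    using assms(2,3) by auto
  have "(P has_vector_derivative p (s + h)) (at (s + h) within (\<lambda>s. s + h) ` {c..r})"
    using has_vector_derivative_within_subset[OF P sub(1)] sub(1) assms(4) by auto
  then have "(P \<circ> (\<lambda>s. s + h) has_vector_derivative 1 *\<^sub>R p (s + h)) (at s within {c..r})"
    by (intro vector_diff_chain_within) (auto intro!: derivative_eq_intros)
  moreover have "(P has_vector_derivative p s) (at s within {c..r})"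
    using has_vector_derivative_within_subset[OF P sub(2)] sub(2) assms(4) by auto
  ultimately show ?thesis
    by (intro bounded_linear.has_vector_derivative[OF bounded_linear_scaleR_right]
        has_vector_derivative_diff) (simp_all add: o_def)
qed

text \<open>
  The velocity of a weak solution is not \<open>V\<close>-valued, so the equation cannot be tested with it.
  The averages \<open>u\<^sub>h(s) = 1/h \<integral>\<^bsub>s\<^esub>\<^bsup>s+h\<^esup> u\<close> have the \<open>V\<close>-valued velocity \<open>(u(s+h) - u(s))/h\<close> and satisfy
  the averaged equation, and the energy identity passes to the limit \<open>h \<rightarrow> 0\<close>.
\<close>

lemma weak_energy_derivative:
  fixes j :: "'v::{real_inner, complete_space} \<Rightarrow>\<^sub>L 'h::{real_inner, complete_space}"
  assumes cu: "continuous_on {c..e} u" and cut: "continuous_on {c..e} ut"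
    and cf: "continuous_on {c..e} f"
    and du: "\<And>s. s\<in>{c..e} \<Longrightarrow> ((\<lambda>r. j (u r)) has_vector_derivative ut s) (at s within {c..e})"
    and eq: "\<And>s. s\<in>{c..e} \<Longrightarrow> ((\<lambda>r. pivot j (ut r)) has_vector_derivative
               - (ext_A (u s) + pivot j (f s))) (at s within {c..e})"
    and r: "c < r" "r < e"
  shows "(energy u ut has_real_derivative - (f r \<bullet> ut r)) (at r)"
proof -
  \<comment> \<open>The margin \<open>e - b\<close> leaves room for the forward averages over
    \<open>{s..s + h k}\<close> at all \<open>s\<close> in \<open>{c..b}\<close>.\<close>
  define b where "b = (r + e) / 2"
  have b: "r < b" "b < e"
    using r by (auto simp: b_def)
  define h where "h k = (e - b) / real (Suc k)" for k
  have h0: "h \<longlonglongrightarrow> 0"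
    unfolding h_def by (rule LIMSEQ_Suc[OF lim_const_over_n])
  have h: "0 < h k \<and> h k \<le> e - b" for k
    using b by (auto simp: h_def field_simps intro: mult_right_mono)
  obtain U where dU: "\<And>s. s \<in> {c..e} \<Longrightarrow> (U has_vector_derivative u s) (at s within {c..e})"
    using antiderivative_exists[OF cu] by blast
  obtain F where dF: "\<And>s. s \<in> {c..e} \<Longrightarrow> (F has_vector_derivative f s) (at s within {c..e})"
    using antiderivative_exists[OF cf] by blast
  \<comment> \<open>Applied to the primitives \<open>U\<close> and \<open>F\<close>, these quotients
    are the averages of \<open>u\<close> and \<open>f\<close>. Applied to \<open>j (u r)\<close>,
    they give the average of \<open>ut\<close>, which is also the image under \<open>j\<close> of
    the velocity of the averaged solution.\<close>
  define q where "q k x s = (1 / h k) *\<^sub>R (x (s + h k) - x s)" for k s and x :: "real \<Rightarrow> 'h"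
  define qv where "qv k x s = (1 / h k) *\<^sub>R (x (s + h k) - x s)" for k s and x :: "real \<Rightarrow> 'v"

  \<comment> \<open>The equation integrated once in time; differences of the resulting constant are
    the averaged equation.\<close>
  have "((\<lambda>s. pivot j (ut s) + (ext_A (U s) + pivot j (F s))) has_vector_derivative 0) (at s within {c..e})"
    if "s \<in> {c..e}" for s
    using has_vector_derivative_add[OF eq has_vector_derivative_add[OF
        bounded_linear.has_vector_derivative[OF bounded_linear_ext_A dU]
        bounded_linear.has_vector_derivative[OF bounded_linear_pivot[of j] dF]]] that by simp
  then obtain \<kappa> where \<kappa>: "\<And>s. s \<in> {c..e} \<Longrightarrow> pivot j (ut s) + (ext_A (U s) + pivot j (F s)) = \<kappa>"
    by (rule has_vector_derivative_zero_constant[OF convex_real_interval(5)]) auto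
  have averaged: "qv k U s \<bullet> v + q k ut s \<bullet> j v = - (q k F s \<bullet> j v)" if "s \<in> {c..b}" for k s v
  proof -
    have "s \<in> {c..e}" "s + h k \<in> {c..e}"
      using that h[of k] b by auto
    then have "blinfun_apply (pivot j (ut (s + h k)) + (ext_A (U (s + h k)) + pivot j (F (s + h k)))) v
        = blinfun_apply (pivot j (ut s) + (ext_A (U s) + pivot j (F s))) v"
      by (simp only: \<kappa>)
    then have *: "(U (s + h k) - U s) \<bullet> v + (ut (s + h k) - ut s) \<bullet> j v = - ((F (s + h k) - F s) \<bullet> j v)"
      by (simp add: blinfun.add_left inner_diff_left)
    have "qv k U s \<bullet> v + q k ut s \<bullet> j v
        = (1 / h k) * ((U (s + h k) - U s) \<bullet> v + (ut (s + h k) - ut s) \<bullet> j v)"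
      by (simp add: q_def qv_def distrib_left)
    then show ?thesis
      unfolding * by (simp add: q_def)
  qed
  have vel: "j (qv k u s) = q k (\<lambda>r. j (u r)) s" for k s
    by (simp add: q_def qv_def blinfun.scaleR_right blinfun.diff_right)
  define E where "E k = energy (qv k U) (q k (\<lambda>r. j (u r)))" for k
  have dE: "(E k has_real_derivative - (q k F s \<bullet> q k (\<lambda>r. j (u r)) s)) (at s within {c..b})"
    if "s \<in> {c..b}" for k s
  proof -
    have le: "0 \<le> h k" "b + h k \<le> e"
      using h[of k] by auto
    have "(qv k U has_vector_derivative qv k u s) (at s within {c..b})"
      unfolding qv_def by (rule has_vector_derivative_difference_quotient[OF dU le that])
    moreover have "(q k (\<lambda>r. j (u r)) has_vector_derivative q k ut s) (at s within {c..b})"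
      unfolding q_def by (rule has_vector_derivative_difference_quotient[OF du le that])
    ultimately have "(E k has_real_derivative
        qv k U s \<bullet> qv k u s + q k (\<lambda>r. j (u r)) s \<bullet> q k ut s) (at s within {c..b})"
      unfolding E_def by (rule energy_has_derivative)
    \<comment> \<open>The test vector is the velocity \<open>qv k u s\<close> of the averaged
      solution, so only the forcing term survives.\<close>
    then show ?thesis
      using averaged[OF that, of k "qv k u s"] by (simp add: vel inner_commute)
  qed
  have limU: "uniform_limit {c..b} (\<lambda>k. qv k U) u sequentially"
    unfolding qv_def by (rule uniform_limit_difference_quotient[OF cu dU h0 h])
  have limu: "uniform_limit {c..b} (\<lambda>k. q k (\<lambda>r. j (u r))) ut sequentially"
    unfolding q_def by (rule uniform_limit_difference_quotient[OF cut du h0 h])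
  have limF: "uniform_limit {c..b} (\<lambda>k. q k F) f sequentially"
    unfolding q_def by (rule uniform_limit_difference_quotient[OF cf dF h0 h])
  have limE: "(\<lambda>k. E k s) \<longlonglongrightarrow> energy u ut s" if "s \<in> {c..b}" for s
    unfolding E_def energy_def
    by (intro tendsto_intros tendsto_uniform_limitI[OF limU that] tendsto_uniform_limitI[OF limu that])
  have bdd: "bounded (f ` {c..b})" "bounded (ut ` {c..b})"
    using b by (auto intro!: compact_imp_bounded compact_continuous_image
        continuous_on_subset[OF cf] continuous_on_subset[OF cut])
  have lim': "uniform_limit {c..b} (\<lambda>k s. q k F s \<bullet> q k (\<lambda>r. j (u r)) s) (\<lambda>s. f s \<bullet> ut s) sequentially"
    by (rule bounded_bilinear.bounded_uniform_limit[OF bounded_bilinear_inner limF limu bdd(2,1)])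
  \<comment> \<open>Uniform convergence of the derivatives, together with convergence of the
    energies, makes the limit energy differentiable with the limiting derivative.\<close>
  have "\<exists>g. \<forall>s\<in>{c..b}. (\<lambda>k. E k s) \<longlonglongrightarrow> g s \<and>
          (g has_derivative (*) (- (f s \<bullet> ut s))) (at s within {c..b})"
  proof (rule has_derivative_sequence)
    show "(E k has_derivative (*) (- (q k F s \<bullet> q k (\<lambda>r. j (u r)) s))) (at s within {c..b})"
      if "s \<in> {c..b}" for k s
      using dE[OF that] by (simp add: has_field_derivative_def)
    show "\<forall>\<^sub>F k in sequentially. \<forall>s\<in>{c..b}. \<forall>x.
        norm (- (q k F s \<bullet> q k (\<lambda>r. j (u r)) s) * x - - (f s \<bullet> ut s) * x) \<le> \<epsilon> * norm x" 
      if "0 < \<epsilon>" for \<epsilon> :: real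
      using uniform_limitD[OF lim' that]
    proof eventually_elim
      case (elim k)
      show ?case
      proof (intro ballI allI)
        fix s x :: real assume "s \<in> {c..b}"
        then have *: "\<bar>f s \<bullet> ut s - q k F s \<bullet> q k (\<lambda>r. j (u r)) s\<bar> \<le> \<epsilon>"
          using elim by (simp add: dist_real_def abs_minus_commute less_imp_le)
        have "- (q k F s \<bullet> q k (\<lambda>r. j (u r)) s) * x - - (f s \<bullet> ut s) * x
            = (f s \<bullet> ut s - q k F s \<bullet> q k (\<lambda>r. j (u r)) s) * x"
          by (simp add: algebra_simps)
        then show "norm (- (q k F s \<bullet> q k (\<lambda>r. j (u r)) s) * x - - (f s \<bullet> ut s) * x) \<le> \<epsilon> * norm x"
          using mult_right_mono[OF *, of "\<bar>x\<bar>"] by (simp add: abs_mult)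
      qed
    qed
    show "(\<lambda>k. E k r) \<longlonglongrightarrow> energy u ut r" "r \<in> {c..b}"
      using limE r b by auto
  qed simp
  then obtain g where g: "\<And>s. s\<in>{c..b} \<Longrightarrow> (\<lambda>k. E k s) \<longlonglongrightarrow> g s"
      "\<And>s. s\<in>{c..b} \<Longrightarrow> (g has_real_derivative - (f s \<bullet> ut s)) (at s within {c..b})"
    unfolding has_field_derivative_def by blast
  have gE: "g s = energy u ut s" if "s \<in> {c..b}" for s
    using LIMSEQ_unique[OF g(1) limE] that by auto
  have "(g has_real_derivative - (f r \<bullet> ut r)) (at r)"
    using g(2)[of r] r b by (simp add: at_within_Icc_at)
  moreover have "\<forall>\<^sub>F s in nhds r. g s = energy u ut s"
    using eventually_nhds_in_open[of "{c<..<b}" r] r b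
    by (auto elim!: eventually_mono simp: gE)
  ultimately show ?thesis
    using DERIV_cong_ev[of r r g "energy u ut"] by simp
qed

subsection \<open>Completeness of \<open>L\<^sup>2\<close>\<close>

text \<open>Fatou's lemma with a moving bound: \<open>C l\<close> will be the energy drop of the
  \<open>l\<close>-th approximant, known only to converge.\<close>

lemma fatou_integral:
  fixes F :: "nat \<Rightarrow> 'a \<Rightarrow> real"
  assumes int: "\<And>l. integrable M (F l)" and nonneg: "\<And>l x. 0 \<le> F l x"
    and G: "G \<in> borel_measurable M" "\<And>x. 0 \<le> G x" and lim: "AE x in M. (\<lambda>l. F l x) \<longlonglongrightarrow> G x"
    and le: "\<And>l. integral\<^sup>L M (F l) \<le> C l" and C: "C \<longlonglongrightarrow> c"
  shows "integrable M G" and "integral\<^sup>L M G \<le> c"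
proof -
  have "c \<ge> 0"
    by (rule LIMSEQ_le_const[OF C]) (meson le nonneg Bochner_Integration.integral_nonneg order_trans)
  have "(\<integral>\<^sup>+x. ennreal (G x) \<partial>M) = (\<integral>\<^sup>+x. liminf (\<lambda>l. ennreal (F l x)) \<partial>M)"
  proof (rule nn_integral_cong_AE)
    show "AE x in M. ennreal (G x) = liminf (\<lambda>l. ennreal (F l x))"
      using lim by eventually_elim (rule lim_imp_Liminf[symmetric], auto)
  qed
  also have "\<dots> \<le> liminf (\<lambda>l. \<integral>\<^sup>+x. ennreal (F l x) \<partial>M)"
    using int by (intro nn_integral_liminf) auto
  also have "\<dots> = liminf (\<lambda>l. ennreal (integral\<^sup>L M (F l)))"
    using int nonneg by (simp add: nn_integral_eq_integral)
  also have "\<dots> \<le> liminf (\<lambda>l. ennreal (C l))"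
    by (intro Liminf_mono always_eventually allI ennreal_leI le)
  also have "\<dots> = ennreal c"
    by (rule lim_imp_Liminf) (auto intro!: C)
  finally have *: "(\<integral>\<^sup>+x. ennreal (G x) \<partial>M) \<le> ennreal c" .
  then show int: "integrable M G"
    using G by (intro integrableI_nonneg) (auto simp: less_top[symmetric] top_unique)
  show "integral\<^sup>L M G \<le> c"
    using * nn_integral_eq_integral[OF int] G \<open>c \<ge> 0\<close> by simp
qed

text \<open>For \<open>y = 2 ^ k * norm (x k)\<close>, the inequality
  \<open>y \<le> y ^ 2 + 1\<close> divided by \<open>2 ^ k\<close> bounds the norm by the weighted
  square plus \<open>(1/2) ^ k\<close>.\<close>

lemma summable_norm_if_weighted_squares:
  fixes x :: "nat \<Rightarrow> 'a::real_normed_vector"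
  assumes "summable (\<lambda>k. 2 ^ k * (norm (x k))\<^sup>2)"
  shows "summable (\<lambda>k. norm (x k))"
proof (rule summable_comparison_test')
  show "summable (\<lambda>k. 2 ^ k * (norm (x k))\<^sup>2 + (1 / 2) ^ k)"
    using assms by (intro summable_add) auto
  fix k :: nat
  define n where "n = norm (x k)"
  have "0 \<le> (2 ^ k * n - 1)\<^sup>2 + 2 ^ k * n + (2 ^ k * n) * 0"
    by (simp add: n_def)
  then have "2 ^ k * n \<le> (2 ^ k * n)\<^sup>2 + 1"
    by (simp add: power2_eq_square algebra_simps)
  then have "2 ^ k * n \<le> 2 ^ k * (2 ^ k * n\<^sup>2 + (1 / 2) ^ k)"
    by (simp add: power2_eq_square algebra_simps power_one_over)
  then have "n \<le> 2 ^ k * n\<^sup>2 + (1 / 2) ^ k"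
    by simp
  then show "norm (norm (x k)) \<le> 2 ^ k * (norm (x k))\<^sup>2 + (1 / 2) ^ k"
    by (simp add: n_def)
qed

text \<open>
  The target space is not assumed to be separable, so sums and differences of measurable
  functions need not be measurable; measurability is obtained from continuity of the \<open>f k\<close>.
\<close>

lemma L2_complete_diagonal:
  fixes f :: "nat \<Rightarrow> real \<Rightarrow> 'u::{real_inner, complete_space}"
  assumes \<beta>: "mono \<beta>" "\<And>k. \<beta> k < b" "\<beta> \<longlonglongrightarrow> b"
    and cont: "\<And>k. continuous_on {a..\<beta> k} (f k)"
    and le: "\<And>k l. k \<le> l \<Longrightarrow>
      (LINT s:{a..\<beta> k}|lborel. (norm (f k s - f l s))\<^sup>2) \<le> 4 * (1/4) ^ k"
  obtains g where "g \<in> borel_measurable lborel" 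
    and "\<And>s. s \<notin> {a..<b} \<Longrightarrow> g s = 0"
    and "AE s in lborel. s \<in> {a..<b} \<longrightarrow> (\<lambda>k. f k s) \<longlonglongrightarrow> g s"
    and "\<And>k. set_integrable lborel {a..\<beta> k} (\<lambda>s. (norm (f k s - g s))\<^sup>2)"
    and "\<And>k. (LINT s:{a..\<beta> k}|lborel. (norm (f k s - g s))\<^sup>2) \<le> 4 * (1/4) ^ k"
proof -
  have cont': "continuous_on {a..\<beta> k} (f l)" if "k \<le> l" for k l
    using monoD[OF \<beta>(1) that] by (intro continuous_on_subset[OF cont[of l]]) auto
  have ev: "\<forall>\<^sub>F k in sequentially. s \<in> {a..\<beta> k}" if "s \<in> {a..<b}" for s
    using order_tendstoD(1)[OF \<beta>(3), of s] that by (auto elim!: eventually_mono)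
  define D where "D k l s = indicator {a..\<beta> k} s *\<^sub>R (norm (f k s - f l s))\<^sup>2" for k l s
  have D: "integrable lborel (D k l)" if "k \<le> l" for k l
    unfolding D_def set_integrable_def[symmetric]
    by (intro borel_integrable_atLeastAtMost' continuous_intros cont cont' that)
  have D_nonneg: "0 \<le> D k l s" for k l s
    by (simp add: D_def)
  have D_le: "integral\<^sup>L lborel (D k l) \<le> 4 * (1/4) ^ k" if "k \<le> l" for k l
    using le[OF that] by (simp add: D_def[abs_def] set_lebesgue_integral_def)

  \<comment> \<open>The weight \<open>2 ^ k\<close> turns the rate \<open>(1/4) ^ k\<close> into
    \<open>(1/2) ^ k\<close>, which is still summable. Hence the weighted sum of squared increments
    is finite almost everywhere, and there the increments are absolutely summable.\<close>
  have "(\<integral>\<^sup>+s. (\<Sum>k. ennreal (2 ^ k * D k (Suc k) s)) \<partial>lborel)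
      = (\<Sum>k. \<integral>\<^sup>+s. ennreal (2 ^ k * D k (Suc k) s) \<partial>lborel)"
    using D by (intro nn_integral_suminf) (auto intro!: borel_measurable_integrable)
  also have "\<dots> = (\<Sum>k. ennreal (2 ^ k * integral\<^sup>L lborel (D k (Suc k))))"
    using D D_nonneg by (intro suminf_cong, subst nn_integral_eq_integral) auto
  also have "\<dots> \<le> (\<Sum>k. ennreal (4 * (1/2) ^ k))"
  proof (intro suminf_le summableI ennreal_leI)
    fix k :: nat
    have "2 ^ k * integral\<^sup>L lborel (D k (Suc k)) \<le> 2 ^ k * (4 * (1/4) ^ k)"
      using D_le[of k "Suc k"] by (intro mult_left_mono) auto
    also have "\<dots> = 4 * (1/2) ^ k"
      by (simp add: power_mult_distrib[symmetric])
    finally show "2 ^ k * integral\<^sup>L lborel (D k (Suc k)) \<le> 4 * (1/2) ^ k" .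
  qed
  also have "\<dots> = ennreal (\<Sum>k. 4 * (1/2) ^ k)"
    by (rule suminf_ennreal2) (auto intro!: summable_mult)
  finally have "(\<integral>\<^sup>+s. (\<Sum>k. ennreal (2 ^ k * D k (Suc k) s)) \<partial>lborel) \<noteq> \<infinity>"
    by (auto simp: top_unique)
  then have "AE s in lborel. (\<Sum>k. ennreal (2 ^ k * D k (Suc k) s)) \<noteq> \<infinity>"
    using D by (intro nn_integral_PInf_AE) (auto intro!: borel_measurable_integrable)
  then have "AE s in lborel. s \<in> {a..<b} \<longrightarrow> convergent (\<lambda>k. f k s)"
  proof eventually_elim
    case (elim s)
    show ?case
    proof
      assume s: "s \<in> {a..<b}"
      have "summable (\<lambda>k. 2 ^ k * D k (Suc k) s)"
        using elim by (intro summable_suminf_not_top) (auto simp: D_nonneg)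
      \<comment> \<open>At a fixed \<open>s < b\<close> the indicator hidden in \<open>D\<close>
        equals one for all large \<open>k\<close>.\<close>
      also have "?this \<longleftrightarrow> summable (\<lambda>k. 2 ^ k * (norm (f k s - f (Suc k) s))\<^sup>2)"
        by (intro summable_cong eventually_mono[OF ev[OF s]]) (simp add: D_def)
      finally show "convergent (\<lambda>k. f k s)"
        by (rule convergent_if_summable_norm_diff[OF summable_norm_if_weighted_squares])
    qed
  qed
  then obtain N where N: "{s \<in> space lborel. \<not> (s \<in> {a..<b} \<longrightarrow> convergent (\<lambda>k. f k s))} \<subseteq> N"
      "N \<in> null_sets lborel"
    unfolding eventually_ae_filter by blast
  have N_sets [measurable]: "N \<in> sets borel"
    using N(2) by auto
  \<comment> \<open>The value zero on the exceptional null set makes \<open>g\<close> an everywhere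
    pointwise limit of measurable functions.\<close>
  define g where "g s = (if s \<in> N \<or> s \<notin> {a..<b} then 0 else lim (\<lambda>k. f k s))" for s
  have lim: "(\<lambda>k. f k s) \<longlonglongrightarrow> g s" if "s \<in> {a..<b}" "s \<notin> N" for s
    using that N(1) by (auto simp: g_def convergent_LIMSEQ_iff)

  show thesis
  proof (rule that[of g])
    show "g \<in> borel_measurable lborel"
    proof (rule borel_measurable_LIMSEQ_metric)
      show "(\<lambda>s. if s \<in> N then 0 else indicator {a..\<beta> k} s *\<^sub>R f k s) \<in> borel_measurable lborel" for k
        using borel_measurable_continuous_on_indicator[OF _ cont[of k]] by (intro measurable_If_set) auto
      show "(\<lambda>k. if s \<in> N then 0 else indicator {a..\<beta> k} s *\<^sub>R f k s) \<longlonglongrightarrow> g s" for s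
      proof (cases "s \<in> {a..<b} \<and> s \<notin> N")
        case True
        then have "\<forall>\<^sub>F k in sequentially. f k s = (if s \<in> N then 0 else indicator {a..\<beta> k} s *\<^sub>R f k s)"
          using ev[of s] by (auto elim!: eventually_mono)
        then show ?thesis
          using lim True tendsto_cong by fast
      next
        case False
        then have "s \<notin> N \<Longrightarrow> s \<notin> {a..\<beta> k}" for k
          using \<beta>(2)[of k] by auto
        then have "(if s \<in> N then 0 else indicator {a..\<beta> k} s *\<^sub>R f k s) = 0" for k
          by (simp add: indicator_def)
        moreover have "g s = 0"
          using False by (auto simp: g_def)
        ultimately show ?thesis
          by simp
      qed
    qed
    show "g s = 0" if "s \<notin> {a..<b}" for s
      using that by (simp add: g_def)
    show ae: "AE s in lborel. s \<in> {a..<b} \<longrightarrow> (\<lambda>k. f k s) \<longlonglongrightarrow> g s"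
      using AE_not_in[OF N(2)] by eventually_elim (auto intro: lim)
    fix k
    define G where "G s = indicator {a..\<beta> k} s *\<^sub>R (norm (f k s - g s))\<^sup>2" for s
    have sub: "s \<in> {a..<b}" if "s \<in> {a..\<beta> k}" for s
      using that \<beta>(2)[of k] by auto
    have G_lim: "(\<lambda>l. D k (l + k) s) \<longlonglongrightarrow> G s" if "s \<in> {a..<b} \<Longrightarrow> (\<lambda>k. f k s) \<longlonglongrightarrow> g s" for s
    proof (cases "s \<in> {a..\<beta> k}")
      case True
      have "(\<lambda>l. f (l + k) s) \<longlonglongrightarrow> g s"
        using LIMSEQ_ignore_initial_segment[OF that[OF sub[OF True]]] .
      then show ?thesis
        unfolding D_def G_def by (intro tendsto_intros)
    qed (simp add: D_def G_def)
    have G_meas: "G \<in> borel_measurable lborel"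
    proof (rule borel_measurable_LIMSEQ_metric)
      have "(\<lambda>s. indicator {a..\<beta> k} s *\<^sub>R (norm (f k s))\<^sup>2) \<in> borel_measurable lborel"
        using borel_measurable_continuous_on_indicator[OF _ continuous_on_power[OF continuous_on_norm[OF cont[of k]], of 2]]
        by simp
      \<comment> \<open>On \<open>N\<close> the sequence \<open>D k (l + k)\<close> need not
        converge; but \<open>g\<close> is zero there, so \<open>G\<close> is given by
        \<open>f k\<close> alone.\<close>
      then show "(\<lambda>s. if s \<in> N then indicator {a..\<beta> k} s *\<^sub>R (norm (f k s))\<^sup>2 else D k (l + k) s)
          \<in> borel_measurable lborel" for l
        using borel_measurable_integrable[OF D[of k "l + k"]] by (intro measurable_If_set) auto
      show "(\<lambda>l. if s \<in> N then indicator {a..\<beta> k} s *\<^sub>R (norm (f k s))\<^sup>2 else D k (l + k) s) \<longlonglongrightarrow> G s" for s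
      proof (cases "s \<in> N")
        case True
        then show ?thesis
          by (simp add: G_def g_def)
      next
        case False
        then have "(\<lambda>l. D k (l + k) s) \<longlonglongrightarrow> G s"
          by (intro G_lim lim)
        then show ?thesis
          using False by simp
      qed
    qed
    have F: "integrable lborel (D k (l + k))" "0 \<le> D k (l + k) s"
        "integral\<^sup>L lborel (D k (l + k)) \<le> 4 * (1/4) ^ k" "0 \<le> G s" for l s
      using D D_nonneg D_le by (auto simp: G_def)
    have ae': "AE s in lborel. (\<lambda>l. D k (l + k) s) \<longlonglongrightarrow> G s"
      using ae by eventually_elim (rule G_lim, auto)
    note fatou = fatou_integral[OF F(1,2) G_meas F(4) ae' F(3) tendsto_const]
    show "set_integrable lborel {a..\<beta> k} (\<lambda>s. (norm (f k s - g s))\<^sup>2)"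
      using fatou(1) by (simp add: G_def[abs_def] set_integrable_def)
    show "(LINT s:{a..\<beta> k}|lborel. (norm (f k s - g s))\<^sup>2) \<le> 4 * (1/4) ^ k"
      using fatou(2) by (simp add: G_def[abs_def] set_lebesgue_integral_def)
  qed
qed

subsection \<open>Energy identity for the damped equation\<close>

text \<open>\<open>mild_damped\<close> gives unrelated approximating sequences on the compact
  subintervals. One member is chosen on each \<open>{a..\<beta> k}\<close>, with errors at most
  \<open>(1/2) ^ k\<close>, so that a single sequence serves all of \<open>{a..<b}\<close>.\<close>

lemma damped_weak_solution_approx:
  assumes "a < b" and sol: "damped_weak_solution j B1 B1s a b w0 w1 w wt"
  obtains \<beta> Z ZT where "mono \<beta>" and "\<And>k. a < \<beta> k" and "\<And>k. \<beta> k < b" and "\<beta> \<longlonglongrightarrow> b"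
    and "\<And>k. strong_solution j B1 B1s {a..\<beta> k} (Z k) (ZT k)"
    and "\<And>k s. s \<in> {a..\<beta> k} \<Longrightarrow> norm (Z k s - w s) \<le> (1/2) ^ k"
    and "\<And>k s. s \<in> {a..\<beta> k} \<Longrightarrow> norm (j (ZT k s) - wt s) \<le> (1/2) ^ k"
proof -
  have mild: "mild_damped j B1 B1s {a..<b} w wt"
    using sol by (simp add: damped_weak_solution_def)
  \<comment> \<open>The exponent \<open>Suc k\<close> places \<open>\<beta> 0\<close> at the
    midpoint, so even the first interval is nondegenerate.\<close>
  define \<beta> :: "nat \<Rightarrow> real" where "\<beta> k = b - (b - a) * (1/2) ^ Suc k" for k
  have "(1/2::real) ^ Suc k < 1" for k
    by (rule power_Suc_less_one) auto
  then have "(b - a) * (1/2) ^ Suc k < (b - a) * 1" for k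
    using \<open>a < b\<close> by (intro mult_strict_left_mono) auto
  then have "a < \<beta> k" for k
    by (simp add: \<beta>_def less_diff_eq algebra_simps)
  have "\<beta> k < b" for k
    using \<open>a < b\<close> by (simp add: \<beta>_def)
  have "mono \<beta>"
    unfolding \<beta>_def mono_def using \<open>a < b\<close> by (auto intro!: mult_left_mono power_decreasing)
  have "(\<lambda>k. (1/2::real) ^ k) \<longlonglongrightarrow> 0"
    by (rule LIMSEQ_realpow_zero) auto
  then have "(\<lambda>k. b - (b - a) * (1/2) ^ Suc k) \<longlonglongrightarrow> b - (b - a) * 0"
    by (rule tendsto_diff[OF tendsto_const tendsto_mult[OF tendsto_const LIMSEQ_Suc]])
  then have "\<beta> \<longlonglongrightarrow> b"
    by (simp add: \<beta>_def[abs_def])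
  have "\<exists>z zt. strong_solution j B1 B1s {a..\<beta> k} z zt \<and>
      (\<forall>s\<in>{a..\<beta> k}. norm (z s - w s) \<le> (1/2) ^ k \<and> norm (j (zt s) - wt s) \<le> (1/2) ^ k)" for k
  proof -
    have "a < \<beta> k \<and> {a..\<beta> k} \<subseteq> {a..<b}"
      using \<open>a < \<beta> k\<close> \<open>\<beta> k < b\<close> by auto
    from mild[unfolded mild_damped_def, rule_format, OF this]
    obtain z zt where approx: "strong_approx j B1 B1s {a..\<beta> k} z zt w wt"
      by (elim exE)
    have "\<forall>\<^sub>F i in sequentially. \<forall>s\<in>{a..\<beta> k}. dist (z i s) (w s) < (1/2) ^ k"
        "\<forall>\<^sub>F i in sequentially. \<forall>s\<in>{a..\<beta> k}. dist (j (zt i s)) (wt s) < (1/2) ^ k"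
      using approx unfolding strong_approx_def by (auto intro!: uniform_limitD)
    then have "\<forall>\<^sub>F i in sequentially. \<forall>s\<in>{a..\<beta> k}.
        norm (z i s - w s) \<le> (1/2) ^ k \<and> norm (j (zt i s) - wt s) \<le> (1/2) ^ k"
      by eventually_elim (auto simp: dist_norm less_imp_le)
    then obtain i where "\<forall>s\<in>{a..\<beta> k}.
        norm (z i s - w s) \<le> (1/2) ^ k \<and> norm (j (zt i s) - wt s) \<le> (1/2) ^ k"
      using eventually_happens'[OF sequentially_bot] by blast
    then show ?thesis
      using approx unfolding strong_approx_def by blast
  qed
  then obtain Z ZT where strong: "\<And>k. strong_solution j B1 B1s {a..\<beta> k} (Z k) (ZT k)"
    and Z: "\<And>k s. s \<in> {a..\<beta> k} \<Longrightarrow> norm (Z k s - w s) \<le> (1/2) ^ k"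
    and ZT: "\<And>k s. s \<in> {a..\<beta> k} \<Longrightarrow> norm (j (ZT k s) - wt s) \<le> (1/2) ^ k"
    by metis
  show thesis
    by (rule that[OF \<open>mono \<beta>\<close> \<open>\<And>k. a < \<beta> k\<close> \<open>\<And>k. \<beta> k < b\<close> \<open>\<beta> \<longlonglongrightarrow> b\<close> strong Z ZT])
qed

text \<open>The \<open>k\<close>-th approximant is controlled only on its own interval, so the point
  of evaluation has to move with \<open>k\<close>. This is how the energy at the right end
  \<open>b\<close> is reached.\<close>

lemma energy_tendsto:
  assumes cont: "continuous_on I w" "continuous_on I wt"
    and \<sigma>: "\<sigma> \<longlonglongrightarrow> s" "s \<in> I" "\<And>k. \<sigma> k \<in> I"
    and Z: "\<And>k. norm (Z k (\<sigma> k) - w (\<sigma> k)) \<le> (1/2) ^ k"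
    and Y: "\<And>k. norm (Y k (\<sigma> k) - wt (\<sigma> k)) \<le> (1/2) ^ k"
  shows "(\<lambda>k. energy (Z k) (Y k) (\<sigma> k)) \<longlonglongrightarrow> energy w wt s"
proof -
  have half: "(\<lambda>k. (1/2::real) ^ k) \<longlonglongrightarrow> 0"
    by (rule LIMSEQ_realpow_zero) auto
  have "(\<lambda>k. w (\<sigma> k)) \<longlonglongrightarrow> w s" "(\<lambda>k. wt (\<sigma> k)) \<longlonglongrightarrow> wt s"
    using cont \<sigma> by (auto intro!: continuous_on_tendsto_compose[of I _ \<sigma>])
  moreover have "(\<lambda>k. Z k (\<sigma> k) - w (\<sigma> k)) \<longlonglongrightarrow> 0"
    by (rule Lim_null_comparison[OF _ half]) (rule always_eventually, simp add: Z)
  moreover have "(\<lambda>k. Y k (\<sigma> k) - wt (\<sigma> k)) \<longlonglongrightarrow> 0"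
    by (rule Lim_null_comparison[OF _ half]) (rule always_eventually, simp add: Y)
  ultimately have "(\<lambda>k. Z k (\<sigma> k)) \<longlonglongrightarrow> w s" "(\<lambda>k. Y k (\<sigma> k)) \<longlonglongrightarrow> wt s"
    by (auto intro: Lim_transform)
  then show ?thesis
    unfolding energy_def by (intro tendsto_intros)
qed

lemma damped_weak_solution_energy_decreasing:
  assumes "a < b" and "damped_weak_solution j B1 B1s a b w0 w1 w wt"
    and adj: "\<And>s. is_adjoint_dual (B1 s) (B1s s)" and "a \<le> r" "r \<le> s" "s \<le> b"
  shows "energy w wt s \<le> energy w wt r"
proof -
  obtain \<beta> Z ZT where "mono \<beta>" and \<beta>: "\<And>k. a < \<beta> k" "\<And>k. \<beta> k < b" "\<beta> \<longlonglongrightarrow> b"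
    and strong: "\<And>k. strong_solution j B1 B1s {a..\<beta> k} (Z k) (ZT k)"
    and Z: "\<And>k s. s \<in> {a..\<beta> k} \<Longrightarrow> norm (Z k s - w s) \<le> (1/2) ^ k"
    and ZT: "\<And>k s. s \<in> {a..\<beta> k} \<Longrightarrow> norm (j (ZT k s) - wt s) \<le> (1/2) ^ k"
    by (rule damped_weak_solution_approx[OF assms(1,2)]) (rule that)
  have cont_w: "continuous_on {a..b} w" "continuous_on {a..b} wt"
    using assms(2) by (auto simp: damped_weak_solution_def finite_energy_def)
  have lim: "(\<lambda>k. energy (Z k) (\<lambda>s. j (ZT k s)) (\<sigma> k)) \<longlonglongrightarrow> energy w wt s"
    if "\<And>k. \<sigma> k \<in> {a..\<beta> k}" "\<sigma> \<longlonglongrightarrow> s" "s \<in> {a..b}" for \<sigma> s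
  proof (rule energy_tendsto[OF cont_w that(2,3)])
    show "\<sigma> k \<in> {a..b}" for k
      using that(1)[of k] \<beta>(2)[of k] by auto
  qed (use that(1) Z ZT in blast)+
  \<comment> \<open>Truncation at \<open>\<beta> k\<close> stays inside the \<open>k\<close>-th
    interval and respects the order of two points; for \<open>x = b\<close> it approaches from the
    left.\<close>
  have energy_lim: "(\<lambda>k. energy (Z k) (\<lambda>s. j (ZT k s)) (min x (\<beta> k))) \<longlonglongrightarrow> energy w wt x"
    if "x \<in> {a..b}" for x
  proof (rule lim)
    have "(\<lambda>k. min x (\<beta> k)) \<longlonglongrightarrow> min x b"
      by (intro tendsto_intros \<beta>)
    then show "(\<lambda>k. min x (\<beta> k)) \<longlonglongrightarrow> x"
      using that by (simp add: min_absorb1)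
  qed (use that \<beta>(1) in \<open>auto intro: less_imp_le\<close>)
  show ?thesis
  proof (rule LIMSEQ_le[OF energy_lim energy_lim])
    have "energy (Z k) (\<lambda>s. j (ZT k s)) (min s (\<beta> k)) \<le> energy (Z k) (\<lambda>s. j (ZT k s)) (min r (\<beta> k))" for k
      using \<beta>(1)[of k] assms(4-6) by (intro strong_solution_energy_decreasing[OF strong adj]) auto
    then show "\<exists>N. \<forall>k\<ge>N. energy (Z k) (\<lambda>s. j (ZT k s)) (min s (\<beta> k))
        \<le> energy (Z k) (\<lambda>s. j (ZT k s)) (min r (\<beta> k))"
      by blast
  qed (use assms in auto)
qed

text \<open>Young's inequality. It compares integrals of squares through \<open>norm y\<close> and
  \<open>norm (x - y)\<close>, without a mixed inner product whose measurability would be in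
  question.\<close>

lemma norm_power2_le_weighted:
  fixes x y :: "'a::real_normed_vector"
  assumes "0 < \<delta>"
  shows "(norm x)\<^sup>2 \<le> (1 + \<delta>) * (norm y)\<^sup>2 + (1 + 1 / \<delta>) * (norm (x - y))\<^sup>2"
proof -
  define p q where "p = norm y" and "q = norm (x - y)"
  have "norm x \<le> p + q"
    using norm_triangle_ineq[of y "x - y"] by (simp add: p_def q_def)
  then have "(norm x)\<^sup>2 \<le> (p + q)\<^sup>2"
    by (rule power_mono) simp
  also have "\<dots> = (1 + \<delta>) * p\<^sup>2 + (1 + 1 / \<delta>) * q\<^sup>2 - (\<delta> * p - q)\<^sup>2 / \<delta>"
    using assms by (simp add: field_simps power2_eq_square)
  also have "\<dots> \<le> (1 + \<delta>) * p\<^sup>2 + (1 + 1 / \<delta>) * q\<^sup>2"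
    using assms by simp
  finally show ?thesis
    by (simp add: p_def q_def)
qed

text \<open>The energy identity for differences makes the damping terms of the diagonal sequence
  Cauchy in \<open>L^2\<close> with a rate. Fatou's lemma bounds the integral of the limit by the
  energy drop. For the opposite bound, the \<open>k\<close>-th drop is compared with the limit at
  the cost of a factor \<open>1 + \<delta>\<close>; then \<open>k\<close> tends to infinity, and
  afterwards \<delta> to zero.\<close>

lemma damped_weak_solution_energy_identity:
  fixes B1s :: "real \<Rightarrow> 'v::real_inner \<Rightarrow>\<^sub>L 'u::{real_inner, complete_space}"
  assumes "a < b" and sol: "damped_weak_solution j B1 B1s a b w0 w1 w wt"
    and adj: "\<And>s. is_adjoint_dual (B1 s) (B1s s)" and cont: "continuous_on {a..<b} B1s"
  obtains g where "damping_trace j B1 B1s {a..<b} w wt g"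
    and "(LINT s:{a..b}|lborel. (norm (g s))\<^sup>2) = energy w wt a - energy w wt b"
proof -
  obtain \<beta> Z ZT where \<beta>: "mono \<beta>" "\<And>k. a < \<beta> k" "\<And>k. \<beta> k < b" "\<beta> \<longlonglongrightarrow> b"
    and strong: "\<And>k. strong_solution j B1 B1s {a..\<beta> k} (Z k) (ZT k)"
    and Z: "\<And>k s. s \<in> {a..\<beta> k} \<Longrightarrow> norm (Z k s - w s) \<le> (1/2) ^ k"
    and ZT: "\<And>k s. s \<in> {a..\<beta> k} \<Longrightarrow> norm (j (ZT k s) - wt s) \<le> (1/2) ^ k"
    by (rule damped_weak_solution_approx[OF assms(1,2)]) (rule that)
  have cont_w: "continuous_on {a..b} w" "continuous_on {a..b} wt"
    using assms(2) by (auto simp: damped_weak_solution_def finite_energy_def)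
  have lim: "(\<lambda>k. energy (Z k) (\<lambda>s. j (ZT k s)) (\<sigma> k)) \<longlonglongrightarrow> energy w wt s"
    if "\<And>k. \<sigma> k \<in> {a..\<beta> k}" "\<sigma> \<longlonglongrightarrow> s" "s \<in> {a..b}" for \<sigma> s
  proof (rule energy_tendsto[OF cont_w that(2,3)])
    show "\<sigma> k \<in> {a..b}" for k
      using that(1)[of k] \<beta>(3)[of k] by auto
  qed (use that(1) Z ZT in blast)+
  define f where "f k s = B1s s (ZT k s)" for k s
  let ?E = "\<lambda>k. energy (Z k) (\<lambda>s. j (ZT k s))"
  have f_cont: "continuous_on {a..\<beta> k} (f k)" for k
    unfolding f_def
  proof (rule bounded_bilinear.continuous_on[OF bounded_bilinear_blinfun_apply])
    show "continuous_on {a..\<beta> k} B1s"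
      using \<beta>(3)[of k] by (intro continuous_on_subset[OF cont]) auto
    show "continuous_on {a..\<beta> k} (ZT k)"
      using strong[of k] by (simp add: strong_solution_def)
  qed
  have f_diff: "(LINT s:{a..\<beta> k}|lborel. (norm (f k s - f l s))\<^sup>2) \<le> 4 * (1/4) ^ k" if "k \<le> l" for k l
  proof -
    have \<beta>kl: "\<beta> k \<le> \<beta> l"
      using \<beta>(1) that by (rule monoD)
    have "strong_solution j B1 B1s {a..\<beta> k} (Z l) (ZT l)"
      using \<beta>kl by (intro strong_solution_subset[OF strong[of l]]) auto
    from strong_solution_energy[OF strong_solution_diff[OF strong[of k] this] adj less_imp_le[OF \<beta>(2)]]
    have "(LINT s:{a..\<beta> k}|lborel. (norm (f k s - f l s))\<^sup>2)
        \<le> energy (\<lambda>s. Z k s - Z l s) (\<lambda>s. j (ZT k s - ZT l s)) a"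
      using energy_nonneg[of "\<lambda>s. Z k s - Z l s" "\<lambda>s. j (ZT k s - ZT l s)" "\<beta> k"]
      by (auto dest!: has_bochner_integral_integral_eq
          simp: set_lebesgue_integral_def f_def blinfun.diff_right)
    \<comment> \<open>As \<open>k \<le> l\<close>, both approximants are within
      \<open>(1/2) ^ k\<close> of the weak solution at \<open>a\<close>; this is the origin of the
      constant \<open>4 * (1/4) ^ k\<close>.\<close>
    also have "\<dots> \<le> (1/2) * ((2 * (1/2) ^ k)\<^sup>2 + (2 * (1/2) ^ k)\<^sup>2)"
      unfolding energy_def
    proof (intro mult_left_mono add_mono power_mono)
      have a: "a \<in> {a..\<beta> k}" "a \<in> {a..\<beta> l}"
        using \<beta>(2)[of k] \<beta>(2)[of l] by auto
      have kl: "(1/2::real) ^ l \<le> (1/2) ^ k"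
        using that by (intro power_decreasing) auto
      show "norm (Z k a - Z l a) \<le> 2 * (1/2) ^ k"
        using norm_triangle_ineq4[of "Z k a - w a" "Z l a - w a"] Z[OF a(1)] Z[OF a(2)] kl
        by (simp del: power_decreasing_iff)
      show "norm (j (ZT k a - ZT l a)) \<le> 2 * (1/2) ^ k"
        using norm_triangle_ineq4[of "j (ZT k a) - wt a" "j (ZT l a) - wt a"] ZT[OF a(1)] ZT[OF a(2)] kl
        unfolding blinfun.diff_right by (simp del: power_decreasing_iff)
    qed auto
    also have "\<dots> = 4 * (1/4) ^ k"
      by (simp add: power_mult_distrib power2_eq_square power_mult_distrib[symmetric])
    finally show ?thesis .
  qed
  obtain g where g_meas: "g \<in> borel_measurable lborel"
    and g_zero: "\<And>s. s \<notin> {a..<b} \<Longrightarrow> g s = 0"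
    and g_lim: "AE s in lborel. s \<in> {a..<b} \<longrightarrow> (\<lambda>k. f k s) \<longlonglongrightarrow> g s"
    and g_int: "\<And>k. set_integrable lborel {a..\<beta> k} (\<lambda>s. (norm (f k s - g s))\<^sup>2)"
    and g_le: "\<And>k. (LINT s:{a..\<beta> k}|lborel. (norm (f k s - g s))\<^sup>2) \<le> 4 * (1/4) ^ k"
    using L2_complete_diagonal[of \<beta> b a f, OF \<beta>(1,3,4) f_cont f_diff] by blast
  have quarter: "(\<lambda>k. 4 * (1/4::real) ^ k) \<longlonglongrightarrow> 0"
    by (intro tendsto_mult_right_zero LIMSEQ_realpow_zero) auto

  define F where "F k s = indicator {a..\<beta> k} s * (norm (f k s))\<^sup>2" for k s
  have F: "has_bochner_integral lborel (F k) (?E k a - ?E k (\<beta> k))" for k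
    unfolding F_def f_def by (rule strong_solution_energy[OF strong adj less_imp_le[OF \<beta>(2)]])
  have F_lim: "(\<lambda>k. ?E k a - ?E k (\<beta> k)) \<longlonglongrightarrow> energy w wt a - energy w wt b"
    using \<beta>(2) \<open>a < b\<close> by (intro tendsto_diff lim tendsto_const \<beta>(4)) (auto intro: less_imp_le)
  have nonneg: "0 \<le> F k s" "0 \<le> (norm (g s))\<^sup>2" for k s
    by (simp_all add: F_def)
  have sq_meas: "(\<lambda>s. (norm (g s))\<^sup>2) \<in> borel_measurable lborel"
    by (rule measurable_compose[OF g_meas], rule borel_measurable_continuous_onI) (intro continuous_intros)
  have F_ae: "AE s in lborel. (\<lambda>k. F k s) \<longlonglongrightarrow> (norm (g s))\<^sup>2"
    using g_lim
  proof eventually_elim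
    case (elim s)
    show ?case
    proof (cases "s \<in> {a..<b}")
      case True
      have "(\<lambda>k. (norm (f k s))\<^sup>2) \<longlonglongrightarrow> (norm (g s))\<^sup>2"
        using elim True by (intro tendsto_intros) auto
      moreover have "\<forall>\<^sub>F k in sequentially. (norm (f k s))\<^sup>2 = F k s"
        using order_tendstoD(1)[OF \<beta>(4), of s] True by (auto elim!: eventually_mono simp: F_def)
      ultimately show ?thesis
        using tendsto_cong by fast
    next
      case False
      then have "F k s = 0" for k
        using \<beta>(3)[of k] by (auto simp: F_def indicator_def)
      then show ?thesis
        using g_zero[OF False] by simp
    qed
  qed
  have F': "integrable lborel (F k)" "integral\<^sup>L lborel (F k) = ?E k a - ?E k (\<beta> k)" for k
    using F[of k] by (auto simp: has_bochner_integral_iff)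
  note fatou = fatou_integral[OF F'(1) nonneg(1) sq_meas nonneg(2) F_ae eq_refl[OF F'(2)] F_lim]
  have "indicator {a..b} s *\<^sub>R (norm (g s))\<^sup>2 = (norm (g s))\<^sup>2" for s
    using g_zero[of s] by (cases "s \<in> {a..b}") auto
  then have G_eq: "(LINT s:{a..b}|lborel. (norm (g s))\<^sup>2) = (LINT s|lborel. (norm (g s))\<^sup>2)"
    unfolding set_lebesgue_integral_def by (simp only:)

  have le: "energy w wt a - energy w wt b \<le> (1 + \<delta>) * (LINT s|lborel. (norm (g s))\<^sup>2)" 
    if "0 < \<delta>" for \<delta> :: real
  proof (rule LIMSEQ_le[OF F_lim])
    show "(\<lambda>k. (1 + \<delta>) * (LINT s|lborel. (norm (g s))\<^sup>2) + (1 + 1 / \<delta>) * (4 * (1/4::real) ^ k))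
        \<longlonglongrightarrow> (1 + \<delta>) * (LINT s|lborel. (norm (g s))\<^sup>2)"
      using tendsto_add[OF tendsto_const tendsto_mult[OF tendsto_const quarter],
          of "(1 + \<delta>) * (LINT s|lborel. (norm (g s))\<^sup>2)" "1 + 1 / \<delta>"] by simp
    have "?E k a - ?E k (\<beta> k)
        \<le> (1 + \<delta>) * (LINT s|lborel. (norm (g s))\<^sup>2) + (1 + 1 / \<delta>) * (4 * (1/4) ^ k)" for k
    proof -
      define d where "d s = indicator {a..\<beta> k} s *\<^sub>R (norm (f k s - g s))\<^sup>2" for s
      have d: "integrable lborel d" "integral\<^sup>L lborel d \<le> 4 * (1/4) ^ k"
        using g_int[of k] g_le[of k] 
        by (simp_all add: d_def[abs_def] set_integrable_def set_lebesgue_integral_def)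
      have "integral\<^sup>L lborel (F k)
          \<le> (LINT s|lborel. (1 + \<delta>) * (norm (g s))\<^sup>2 + (1 + 1 / \<delta>) * d s)"
      proof (rule integral_mono[OF F'(1)])
        show "integrable lborel (\<lambda>s. (1 + \<delta>) * (norm (g s))\<^sup>2 + (1 + 1 / \<delta>) * d s)"
          using fatou(1) d(1) by auto
        show "F k s \<le> (1 + \<delta>) * (norm (g s))\<^sup>2 + (1 + 1 / \<delta>) * d s" for s
          using norm_power2_le_weighted[OF that, of "f k s" "g s"] that
          by (auto simp: F_def d_def indicator_def)
      qed
      also have "\<dots> = (1 + \<delta>) * (LINT s|lborel. (norm (g s))\<^sup>2) + (1 + 1 / \<delta>) * integral\<^sup>L lborel d"
        using fatou(1) d(1) by simp
      also have "\<dots> \<le> (1 + \<delta>) * (LINT s|lborel. (norm (g s))\<^sup>2) + (1 + 1 / \<delta>) * (4 * (1/4) ^ k)"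
        using d(2) that by (intro add_left_mono mult_left_mono) auto
      finally show ?thesis
        by (simp add: F')
    qed
    then show "\<exists>N. \<forall>k\<ge>N. ?E k a - ?E k (\<beta> k)
        \<le> (1 + \<delta>) * (LINT s|lborel. (norm (g s))\<^sup>2) + (1 + 1 / \<delta>) * (4 * (1/4) ^ k)"
      by blast
  qed
  have "((\<lambda>\<delta>. (1 + \<delta>) * (LINT s|lborel. (norm (g s))\<^sup>2)) \<longlongrightarrow> (1 + 0) * (LINT s|lborel. (norm (g s))\<^sup>2))
      (at_right 0)"
    by (intro tendsto_intros)
  then have "energy w wt a - energy w wt b \<le> (1 + 0) * (LINT s|lborel. (norm (g s))\<^sup>2)"
    by (rule tendsto_lowerbound) (auto simp: eventually_at_filter intro!: always_eventually le)
  then have eq: "(LINT s:{a..b}|lborel. (norm (g s))\<^sup>2) = energy w wt a - energy w wt b"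
    using fatou(2) by (simp add: G_eq)

  have "damping_trace j B1 B1s {a..<b} w wt g"
    unfolding damping_trace_def
  proof (intro allI impI, elim conjE)
    fix a' b' assume ab': "a' < b'" "{a'..b'} \<subseteq> {a..<b}"
    then have "a \<le> a'" "b' < b"
      using atLeastAtMost_subseteq_atLeastLessThan_iff[of a' b' a b] by auto
    have "\<forall>\<^sub>F k in sequentially. b' < \<beta> k"
      using order_tendstoD(1)[OF \<beta>(4) \<open>b' < b\<close>] .
    \<comment> \<open>Dropping \<open>K\<close> members leaves approximants that live on all of
      \<open>{a'..b'}\<close>, and the same \<open>g\<close> serves every such subinterval.\<close>
    then obtain K where K: "\<And>k. b' < \<beta> (k + K)"
      unfolding eventually_sequentially by (metis le_add2)
    have sub: "{a'..b'} \<subseteq> {a..\<beta> (k + K)}" for k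
      using K[of k] \<open>a \<le> a'\<close> by auto
    have half: "(\<lambda>k. (1/2::real) ^ (k + K)) \<longlonglongrightarrow> 0"
      by (intro LIMSEQ_ignore_initial_segment LIMSEQ_realpow_zero) auto
    have "strong_approx j B1 B1s {a'..b'} (\<lambda>k. Z (k + K)) (\<lambda>k. ZT (k + K)) w wt"
      unfolding strong_approx_def
    proof (intro conjI allI uniform_limitI)
      show "strong_solution j B1 B1s {a'..b'} (Z (k + K)) (ZT (k + K))" for k
        by (rule strong_solution_subset[OF strong sub])
      fix \<epsilon> :: real assume "0 < \<epsilon>"
      with order_tendstoD(2)[OF half] have ev: "\<forall>\<^sub>F k in sequentially. (1/2) ^ (k + K) < \<epsilon>"
        by blast
      then show "\<forall>\<^sub>F k in sequentially. \<forall>s\<in>{a'..b'}. dist (Z (k + K) s) (w s) < \<epsilon>"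
      proof eventually_elim
        case (elim k)
        then show ?case
          using le_less_trans[OF Z[OF subsetD[OF sub]]] by (simp add: dist_norm)
      qed
      from ev show "\<forall>\<^sub>F k in sequentially. \<forall>s\<in>{a'..b'}. dist (j (ZT (k + K) s)) (wt s) < \<epsilon>"
      proof eventually_elim
        case (elim k)
        then show ?case
          using le_less_trans[OF ZT[OF subsetD[OF sub]]] by (simp add: dist_norm)
      qed
    qed
    moreover have "L2_limit {a'..b'} (\<lambda>k s. B1s s (ZT (k + K) s)) g"
      unfolding L2_limit_def f_def[symmetric]
    proof (intro conjI allI)
      have "(\<lambda>s. if s \<in> {a'..b'} then g s else 0) \<in> borel_measurable lborel"
        using g_meas by (intro measurable_If_set) auto
      then show "set_borel_measurable lborel {a'..b'} g"
        unfolding set_borel_measurable_def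
        by (rule measurable_cong[THEN iffD1, rotated]) (simp add: indicator_def)
      show int: "set_integrable lborel {a'..b'} (\<lambda>s. (norm (f (k + K) s - g s))\<^sup>2)" for k
        by (rule set_integrable_subset[OF g_int _ sub]) simp
      have "(LINT s:{a'..b'}|lborel. (norm (f (k + K) s - g s))\<^sup>2) \<le> 4 * (1/4) ^ (k + K)" for k
      proof -
        have "(LINT s:{a'..b'}|lborel. (norm (f (k + K) s - g s))\<^sup>2)
            \<le> (LINT s:{a..\<beta> (k + K)}|lborel. (norm (f (k + K) s - g s))\<^sup>2)"
          using int g_int sub[of k] unfolding set_lebesgue_integral_def set_integrable_def
          by (intro integral_mono) (auto simp: indicator_def)
        then show ?thesis
          using g_le[of "k + K"] by simp
      qed
      moreover have "0 \<le> (LINT s:{a'..b'}|lborel. (norm (f (k + K) s - g s))\<^sup>2)" for k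
        unfolding set_lebesgue_integral_def by (intro Bochner_Integration.integral_nonneg) simp
      ultimately show "(\<lambda>k. LINT s:{a'..b'}|lborel. (norm (f (k + K) s - g s))\<^sup>2) \<longlonglongrightarrow> 0"
        by (intro Lim_null_comparison[OF _ LIMSEQ_ignore_initial_segment[OF quarter, of K]]
            always_eventually) simp
    qed
    ultimately show "\<exists>z zt. strong_approx j B1 B1s {a'..b'} z zt w wt \<and>
        L2_limit {a'..b'} (\<lambda>k s. B1s s (zt k s)) g"
      by blast
  qed
  with eq show thesis
    by (rule that[rotated])
qed

subsection \<open>Exponential decay\<close>

text \<open>The constant \<open>E\<^sub>0\<close> bounds the delayed energy, which makes the
  differential inequality homogeneous in \<open>energy u ut s + E\<^sub>0\<close>. The derivative is
  taken at interior points only; continuity carries the monotonicity of \<open>?G\<close> to both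
  ends, including \<open>e\<close>, where no equation is available.\<close>

lemma weak_solution_gronwall:
  fixes j :: "'v::{real_inner, complete_space} \<Rightarrow>\<^sub>L 'h::{real_inner, complete_space}"
  assumes fe: "finite_energy j {c..e} u ut" and cf: "continuous_on {c..<e} f"
    and eq: "\<And>s. s\<in>{c..<e} \<Longrightarrow> ((\<lambda>r. pivot j (ut r)) has_vector_derivative
               - (ext_A (u s) + pivot j (f s))) (at s within {c..<e})"
    and bound: "\<And>s. s \<in> {c..<e} \<Longrightarrow> - (f s \<bullet> ut s) \<le> K * (energy u ut s + E\<^sub>0)"
    and s: "s \<in> {c..e}"
  shows "energy u ut s + E\<^sub>0 \<le> exp (K * (s - c)) * (energy u ut c + E\<^sub>0)"
proof -
  have cu: "continuous_on {c..e} u" and cut: "continuous_on {c..e} ut"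
    and du: "\<And>s. s\<in>{c..e} \<Longrightarrow> ((\<lambda>r. j (u r)) has_vector_derivative ut s) (at s within {c..e})"
    using fe by (auto simp: finite_energy_def)
  let ?G = "\<lambda>x. (energy u ut x + E\<^sub>0) * exp (- (K * (x - c)))"
  have "?G s \<le> ?G c"
  proof (rule DERIV_nonpos_imp_decreasing_open[where f = ?G and a = c and b = s])
    show "c \<le> s"
      using s by simp
    show "continuous_on {c..s} ?G"
      unfolding energy_def using s
      by (intro continuous_intros continuous_on_subset[OF cu] continuous_on_subset[OF cut]) auto
    fix x assume x: "c < x" "x < s"
    \<comment> \<open>The energy derivative is known for compact intervals, the equation holds on
      \<open>{c..<e}\<close>; any point strictly between \<open>x\<close> and \<open>e\<close>
      mediates.\<close>
    define e' where "e' = (x + e) / 2"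
    have e': "x < e'" "e' < e"
      using x s by (auto simp: e'_def)
    have sub: "{c..e'} \<subseteq> {c..e}" "{c..e'} \<subseteq> {c..<e}"
      using e' by auto
    have "(energy u ut has_real_derivative - (f x \<bullet> ut x)) (at x)"
    proof (rule weak_energy_derivative[where j=j, OF continuous_on_subset[OF cu sub(1)]
          continuous_on_subset[OF cut sub(1)] continuous_on_subset[OF cf sub(2)]])
      show "((\<lambda>r. j (u r)) has_vector_derivative ut r) (at r within {c..e'})" if "r \<in> {c..e'}" for r
        using has_vector_derivative_within_subset[OF du sub(1)] sub(1) that by blast
      show "((\<lambda>r. pivot j (ut r)) has_vector_derivative - (ext_A (u r) + pivot j (f r)))
          (at r within {c..e'})" if "r \<in> {c..e'}" for r
        using has_vector_derivative_within_subset[OF eq sub(2)] sub(2) that by blast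
    qed (use x e' in auto)
    then have "(?G has_real_derivative
        (- (f x \<bullet> ut x) - K * (energy u ut x + E\<^sub>0)) * exp (- (K * (x - c)))) (at x)"
      by (auto intro!: derivative_eq_intros simp: algebra_simps)
    moreover have "(- (f x \<bullet> ut x) - K * (energy u ut x + E\<^sub>0)) * exp (- (K * (x - c))) \<le> 0"
      using bound[of x] x s by (intro mult_nonpos_nonneg) auto
    ultimately show "\<exists>y. DERIV ?G x :> y \<and> y \<le> 0"
      by blast
  qed
  then have "exp (K * (s - c)) * ?G s \<le> exp (K * (s - c)) * (energy u ut c + E\<^sub>0)"
    by (intro mult_left_mono) auto
  moreover have "exp (K * (s - c)) * ?G s = energy u ut s + E\<^sub>0"
    by (simp add: exp_minus)
  ultimately show ?thesis
    by simp
qed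

text \<open>After \<open>n\<close> full periods the energy is at most \<open>q ^ n\<close> times the
  initial one, and \<open>n > s / P - 1\<close>. The incomplete last period costs the factor
  \<open>1 / q\<close>.\<close>

lemma exponential_decay_if_contraction:
  fixes E :: "real \<Rightarrow> real"
  assumes "0 < P" "0 < q" "q < 1" and E_nonneg: "0 \<le> E 0"
    and le: "\<And>n s. s \<in> {real n * P..real (Suc n) * P} \<Longrightarrow> E s \<le> E (real n * P)"
    and contr: "\<And>n. E (real (Suc n) * P) \<le> q * E (real n * P)"
    and "0 \<le> s"
  shows "E s \<le> 1 / q * exp (- (- ln q / P) * s) * E 0"
proof -
  have pow: "E (real n * P) \<le> q ^ n * E 0" for n
  proof (induction n)
    case (Suc n)
    have "E (real (Suc n) * P) \<le> q * E (real n * P)"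
      by (rule contr)
    also have "\<dots> \<le> q * (q ^ n * E 0)"
      using Suc \<open>0 < q\<close> by (intro mult_left_mono) auto
    finally show ?case
      by simp
  qed simp
  define n where "n = nat \<lfloor>s / P\<rfloor>"
  have n: "real n \<le> s / P" "s / P < real n + 1"
    using \<open>0 \<le> s\<close> \<open>0 < P\<close> by (auto simp: n_def)
  then have "s \<in> {real n * P..real (Suc n) * P}"
    using \<open>0 < P\<close> by (auto simp: field_simps)
  then have "E s \<le> q ^ n * E 0"
    using le pow order_trans by blast
  also have "\<dots> \<le> 1 / q * exp (- (- ln q / P) * s) * E 0"
  proof (rule mult_right_mono[OF _ E_nonneg])
    have "real n * ln q \<le> (s / P - 1) * ln q"
      using n \<open>0 < q\<close> \<open>q < 1\<close> by (intro mult_right_mono_neg) auto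
    then have "exp (real n * ln q) \<le> exp ((s / P - 1) * ln q)"
      by simp
    moreover have "exp (real n * ln q) = q ^ n"
      using \<open>0 < q\<close> by (simp add: exp_of_nat_mult)
    moreover have "exp ((s / P - 1) * ln q) = 1 / q * exp (- (- ln q / P) * s)"
    proof -
      have "(s / P - 1) * ln q = - (- ln q / P) * s - ln q"
        by (simp add: algebra_simps)
      then show ?thesis
        using \<open>0 < q\<close> by (simp add: exp_diff)
    qed
    ultimately show "q ^ n \<le> 1 / q * exp (- (- ln q / P) * s)"
      by simp
  qed
  finally show ?thesis .
qed

text \<open>Cauchy-Schwarz after moving \<open>B2\<close> across. The halves match those in
  \<open>energy\<close>, so \<open>K\<close> itself becomes the growth rate.\<close>

lemma inner_adjoint_le:
  fixes B2 :: "'u::real_inner \<Rightarrow>\<^sub>L 'h::real_inner"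
  assumes "is_adjoint B2 B2s" and le: "\<And>v. (norm (B2s v))\<^sup>2 \<le> K * (norm v)\<^sup>2"
  shows "- (B2 (B2s x) \<bullet> y) \<le> K * ((1/2) * (norm x)\<^sup>2 + (1/2) * (norm y)\<^sup>2)"
proof -
  have "B2 (B2s x) \<bullet> y = B2s x \<bullet> B2s y"
    using assms(1) by (simp add: is_adjoint_def)
  then have "- (B2 (B2s x) \<bullet> y) \<le> norm (B2s x) * norm (B2s y)"
    using norm_cauchy_schwarz[of "- B2s x" "B2s y"] by simp
  also have "\<dots> \<le> (1/2) * ((norm (B2s x))\<^sup>2 + (norm (B2s y))\<^sup>2)"
    using sum_squares_bound[of "norm (B2s x)" "norm (B2s y)"] by simp
  also have "\<dots> \<le> (1/2) * (K * (norm x)\<^sup>2 + K * (norm y)\<^sup>2)"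
    by (intro mult_left_mono add_mono le) simp
  finally show ?thesis
    by (simp add: algebra_simps)
qed

theorem theorem4p5:
  fixes D DS :: "'h::{real_inner, complete_space} set" and A S :: "'h \<Rightarrow> 'h"
    and j :: "'v::{real_inner, complete_space} \<Rightarrow>\<^sub>L 'h"
    and emb_U1 :: "'v \<Rightarrow>\<^sub>L 'u1::{real_inner, complete_space}"
    and emb_W :: "'h \<Rightarrow>\<^sub>L 'w::{real_inner, complete_space}"
    and B1 :: "real \<Rightarrow> 'u1 \<Rightarrow>\<^sub>L ('v \<Rightarrow>\<^sub>L real)" and B1s :: "real \<Rightarrow> 'v \<Rightarrow>\<^sub>L 'u1"
    and B2 :: "real \<Rightarrow> 'u2::{real_inner, complete_space} \<Rightarrow>\<^sub>L 'h" and B2s :: "real \<Rightarrow> 'h \<Rightarrow>\<^sub>L 'u2"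
    and C \<tau> Tstar Ttilde Tbar :: real and t m M :: "nat \<Rightarrow> real"
    and d :: "nat \<Rightarrow> real \<Rightarrow> real"
  assumes "self_adjoint_op D A" and "positive_op D A" and "has_compact_inverse D A"
    and "is_sqrt_op DS S D A" and "form_domain j DS S"
    and "inj (blinfun_apply emb_U1)"
    and "inj (blinfun_apply emb_W)"
    and "0 < C" and "\<And>v. (norm (emb_W v))\<^sup>2 \<le> C * (norm v)\<^sup>2"
    and "0 < \<tau>"
    and "t 0 = 0" and "strict_mono t"
    and "\<And>s. is_adjoint_dual (B1 s) (B1s s)" and "\<And>s. is_adjoint (B2 s) (B2s s)"
    and "\<And>n s. s \<in> {t (2*n)..<t (2*n+1)} \<Longrightarrow> B2 s = 0"
    and "\<And>n s. s \<in> {t (2*n+1)..<t (2*n+2)} \<Longrightarrow> B1 s = 0"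
    and "\<And>n. B2_continuous B2 (t (2*n+1)) (t (2*n+2))"
    and "\<And>n. B1_smooth_bounded j B1 (t (2*n)) (t (2*n+1)) \<or> B1_scaled B1 (t (2*n)) (t (2*n+1))"
    and "\<And>n. 0 < m (2*n) \<and> m (2*n) \<le> M (2*n)" and "\<And>n. 0 < M (2*n+1)"
    and "\<And>n s v. s \<in> {t (2*n)..<t (2*n+1)} \<Longrightarrow>
           m (2*n) * (norm (emb_U1 v))\<^sup>2 \<le> (norm (B1s s v))\<^sup>2 \<and>
           (norm (B1s s v))\<^sup>2 \<le> M (2*n) * (norm (emb_U1 v))\<^sup>2"
    and "\<And>n s v. s \<in> {t (2*n+1)..<t (2*n+2)} \<Longrightarrow>
           (norm (B2s s v))\<^sup>2 \<le> M (2*n+1) * (norm (emb_W v))\<^sup>2"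
    and "\<And>n. t (2*n+1) - t (2*n) = Tstar" and "\<tau> \<le> Tstar"
    and "\<And>n. t (2*n+2) - t (2*n+1) = Ttilde" and "Ttilde \<le> \<tau>"
    and "0 \<le> Tbar" and "Tbar < Tstar"
    and "\<And>n T w0 w1 w wt g.
           \<lbrakk> Tbar < T; T \<le> Tstar;
             damped_weak_solution j B1 B1s (t (2*n)) (t (2*n+1)) w0 w1 w wt;
             damping_trace j B1 B1s {t (2*n)..<t (2*n+1)} w wt g \<rbrakk> \<Longrightarrow>
           energy w wt (t (2*n) + T)
             \<le> d n T * (LINT s:{t (2*n)..t (2*n) + T}|lborel. (norm (g s))\<^sup>2)"
    and "(SUP n. ereal (exp (C * M (2*n+1) * Ttilde) * (d n Tstar / (d n Tstar + 1) + 1) - 1)) < 1"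
  shows "\<exists>\<gamma> \<mu>. 0 < \<gamma> \<and> 0 < \<mu> \<and>
           (\<forall>u0 u1 u ut. delayed_solution j B1 B1s B2 B2s \<tau> t u0 u1 u ut \<longrightarrow>
              (\<forall>s>0. energy u ut s \<le> \<gamma> * exp (- \<mu> * s) * energy u ut 0))"
proof -
  have t_less: "t (2*n) < t (2*n+1)" "t (2*n+1) < t (2*n+2)" for n
    using assms(12) by (auto simp: strict_mono_def)
  define P where "P = Tstar + Ttilde"
  have "0 < Tstar" "0 < Ttilde"
    using assms(23)[of 0] assms(25)[of 0] t_less[of 0] by auto
  then have "0 < P"
    by (simp add: P_def)
  have t_even: "t (2*n) = real n * P" for n
  proof (induction n)
    case (Suc n)
    then show ?case
      using assms(23)[of n] assms(25)[of n] by (simp add: P_def algebra_simps)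
  qed (simp add: assms)
  have t_even': "t (2*n+2) = real (Suc n) * P" for n
    using t_even[of "Suc n"] by simp
  have t_nonneg: "0 \<le> t n" for n
    using strict_mono_less_eq[OF assms(12), of 0 n] assms(11) by simp

  define \<rho> where "\<rho> n = exp (C * M (2*n+1) * Ttilde) * (d n Tstar / (d n Tstar + 1) + 1) - 1" for n
  have sup: "(SUP n. ereal (\<rho> n)) < 1"
    using assms(30) by (simp add: \<rho>_def)
  \<comment> \<open>The supremum lies between \<open>\<rho> 0\<close> and one in
    \<open>ereal\<close>, hence is a real number and bounds all factors at once.\<close>
  obtain q\<^sub>0 where q\<^sub>0: "q\<^sub>0 < 1" "\<And>n. \<rho> n \<le> q\<^sub>0"
  proof (cases "SUP n. ereal (\<rho> n)")
    case (real r)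
    show thesis
    proof (rule that[of r])
      show "r < 1"
        using sup real by simp
      show "\<rho> n \<le> r" for n
        using SUP_upper[of n UNIV "\<lambda>n. ereal (\<rho> n)"] real by simp
    qed
  next
    case PInf
    then show thesis
      using sup by simp
  next
    case MInf
    then show thesis
      using SUP_upper[of 0 UNIV "\<lambda>n. ereal (\<rho> n)"] by simp
  qed
  \<comment> \<open>The maximum guarantees a positive factor, so that \<open>1 / q\<close> and
    \<open>- ln q / P\<close> can serve as the two constants.\<close>
  define q where "q = max q\<^sub>0 (1/2)"
  have q: "0 < q" "q < 1" "\<rho> n \<le> q" for n
    using q\<^sub>0(1) q\<^sub>0(2)[of n] by (auto simp: q_def)

  \<comment> \<open>The first conjunct controls the times strictly inside a period, where the energy
    may grow temporarily.\<close>
  have step: "(\<forall>s\<in>{t (2*n)..t (2*n+2)}. energy u ut s \<le> energy u ut (t (2*n))) \<and>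
      energy u ut (t (2*n+2)) \<le> q * energy u ut (t (2*n))"
    if sol: "delayed_solution j B1 B1s B2 B2s \<tau> t u0 u1 u ut" for u0 u1 u ut n
  proof -
    define a b e where "a = t (2*n)" and "b = t (2*n+1)" and "e = t (2*n+2)"
    have abe: "0 \<le> a" "a < b" "b < e" "b = a + Tstar" "e = b + Ttilde"
      using t_less[of n] t_nonneg[of "2*n"] assms(23)[of n] assms(25)[of n]
      by (auto simp: a_def b_def e_def)
    let ?E = "energy u ut"
    have fe: "finite_energy j {0..} u ut"
      and mild: "mild_damped j B1 B1s {a..<b} u ut"
      and eq: "\<And>s. s \<in> {b..<e} \<Longrightarrow> ((\<lambda>r. pivot j (ut r)) has_vector_derivative
           - (ext_A (u s) + pivot j (B2 s (B2s s (ut (s - \<tau>)))))) (at s within {b..<e})"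
      using sol unfolding delayed_solution_def a_def b_def e_def by blast+
    have fe': "finite_energy j I u ut" if "I \<subseteq> {0..}" for I
      using fe that unfolding finite_energy_def
      by (meson continuous_on_subset has_vector_derivative_within_subset subsetD)
    have weak: "damped_weak_solution j B1 B1s a b (u a) (ut a) u ut"
      unfolding damped_weak_solution_def using mild abe by (intro conjI fe') auto
    have decr: "?E s \<le> ?E r" if "a \<le> r" "r \<le> s" "s \<le> b" for r s
      by (rule damped_weak_solution_energy_decreasing[OF \<open>a < b\<close> weak assms(13) that])
    have "continuous_on {a..<b} B1"
      using assms(18)[of n] unfolding a_def b_def
      by (auto intro: continuous_on_B1_smooth continuous_on_B1_scaled)
    then have "continuous_on {a..<b} B1s"
      by (rule continuous_on_adjoint_dual[OF assms(13)])
    from damped_weak_solution_energy_identity[OF \<open>a < b\<close> weak assms(13) this]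
    obtain g where "damping_trace j B1 B1s {a..<b} u ut g"
      and g: "(LINT s:{a..b}|lborel. (norm (g s))\<^sup>2) = ?E a - ?E b"
      by blast
    \<comment> \<open>The largest admissible time \<open>Tstar\<close> is used:
      \<open>t (2*n) + Tstar\<close> is the right end \<open>b\<close>.\<close>
    from assms(29)[OF assms(28) order_refl weak[unfolded a_def b_def] this(1)[unfolded a_def b_def]]
    have obs: "?E b \<le> d n Tstar * (?E a - ?E b)"
      using g abe(4) by (simp add: a_def)

    define K where "K = C * M (2*n+1)"
    have "0 < K"
      using assms(8,20) by (simp add: K_def)
    \<comment> \<open>Gronwall's inequality with \<open>E\<^sub>0 = ?E a\<close>, which dominates
      every \<open>?E (s - \<tau>)\<close> because the energy decreases on
      \<open>{a..b}\<close>.\<close>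
    have odd: "?E s + ?E a \<le> exp (K * (s - b)) * (?E b + ?E a)" if "s \<in> {b..e}" for s
    proof (rule weak_solution_gronwall[OF fe' _ eq _ that])
      show "{b..e} \<subseteq> {0..}"
        using abe by auto
      obtain G where "continuous_on {b..e} G" and G: "\<And>s. s\<in>{b..<e} \<Longrightarrow> B2 s = G s"
        using assms(17)[of n] unfolding B2_continuous_def b_def e_def by blast
      then have "continuous_on {b..<e} G"
        by (auto elim: continuous_on_subset)
      then have cB2: "continuous_on {b..<e} B2"
        by (rule continuous_on_cong[THEN iffD1, rotated -1]) (simp_all add: G)
      have "continuous_on {0..} ut"
        using fe by (simp add: finite_energy_def)
      then have "continuous_on {b..<e} (\<lambda>s. ut (s - \<tau>))"
        by (rule continuous_on_compose2) (use abe assms(24) in \<open>auto intro!: continuous_intros\<close>)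
      then show "continuous_on {b..<e} (\<lambda>s. B2 s (B2s s (ut (s - \<tau>))))"
        by (intro bounded_bilinear.continuous_on[OF bounded_bilinear_blinfun_apply] cB2
            continuous_on_adjoint[OF assms(14) cB2])
      fix s assume s: "s \<in> {b..<e}"
      have "(norm (B2s s v))\<^sup>2 \<le> K * (norm v)\<^sup>2" for v
      proof -
        have "(norm (B2s s v))\<^sup>2 \<le> M (2*n+1) * (norm (emb_W v))\<^sup>2"
          using assms(22)[of s n v] s by (simp add: b_def e_def)
        also have "\<dots> \<le> M (2*n+1) * (C * (norm v)\<^sup>2)"
          using assms(9,20) by (intro mult_left_mono) (auto intro: less_imp_le)
        finally show ?thesis
          by (simp add: K_def mult_ac)
      qed
      from inner_adjoint_le[OF assms(14) this]
      have "- (B2 s (B2s s (ut (s - \<tau>))) \<bullet> ut s)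
          \<le> K * ((1/2) * (norm (ut (s - \<tau>)))\<^sup>2 + (1/2) * (norm (ut s))\<^sup>2)" .
      also have "\<dots> \<le> K * (?E (s - \<tau>) + ?E s)"
        using \<open>0 < K\<close> by (intro mult_left_mono add_mono) (auto simp: energy_def)
      also have "\<dots> \<le> K * (?E s + ?E a)"
      proof -
        have "?E (s - \<tau>) \<le> ?E a"
          using s abe assms(24,26) by (intro decr) auto
        then show ?thesis
          using \<open>0 < K\<close> by simp
      qed
      finally show "- (B2 s (B2s s (ut (s - \<tau>))) \<bullet> ut s) \<le> K * (?E s + ?E a)" .
    qed auto

    have odd_le: "?E s \<le> q * ?E a" if s: "s \<in> {b..e}" for s
    proof (cases "0 \<le> d n Tstar")
      case True
      define \<delta> where "\<delta> = d n Tstar"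
      have "0 \<le> \<delta>" "?E b * (\<delta> + 1) \<le> \<delta> * ?E a"
        using True obs by (simp_all add: \<delta>_def algebra_simps)
      then have "?E b \<le> \<delta> / (\<delta> + 1) * ?E a"
        by (simp add: field_simps)
      then have "?E b + ?E a \<le> (\<delta> / (\<delta> + 1) + 1) * ?E a"
        by (simp add: algebra_simps)
      moreover have "exp (K * (s - b)) \<le> exp (K * Ttilde)"
        using s abe \<open>0 < K\<close> by simp
      ultimately have "exp (K * (s - b)) * (?E b + ?E a) \<le> exp (K * Ttilde) * ((\<delta> / (\<delta> + 1) + 1) * ?E a)"
        using energy_nonneg[of u ut a] energy_nonneg[of u ut b] by (intro mult_mono) auto
      with odd[OF s] have "?E s \<le> \<rho> n * ?E a"
        by (simp add: \<rho>_def K_def \<delta>_def algebra_simps)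
      also have "\<dots> \<le> q * ?E a"
        by (intro mult_right_mono q energy_nonneg)
      finally show ?thesis .
    next
      text \<open>A negative observability constant forces every solution to vanish on \<open>I\<^sub>2\<^sub>n\<close>.\<close>
      case False
      have "?E b \<le> ?E a"
        using abe by (intro decr) auto
      then have "d n Tstar * (?E a - ?E b) \<le> 0"
        using False by (intro mult_nonpos_nonneg) auto
      with obs energy_nonneg[of u ut b] have "?E b = 0"
        by simp
      \<comment> \<open>This relies on the dissipated integral being all of
        \<open>?E a - ?E b\<close>, and not merely bounded by it.\<close>
      with obs have "0 \<le> d n Tstar * ?E a"
        by simp
      with False have "?E a \<le> 0"
        by (simp add: zero_le_mult_iff)
      then have "?E a = 0"
        using energy_nonneg[of u ut a] by simp
      then show ?thesis
        using odd[OF s] \<open>?E b = 0\<close> by simp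
    qed
    have "?E s \<le> ?E a" if "s \<in> {a..e}" for s
    proof (cases "s \<le> b")
      case True
      then show ?thesis
        using that abe by (intro decr) auto
    next
      case False
      then have "?E s \<le> q * ?E a"
        using that by (intro odd_le) auto
      also have "\<dots> \<le> 1 * ?E a"
        using q by (intro mult_right_mono energy_nonneg) auto
      finally show ?thesis
        by simp
    qed
    moreover have "?E e \<le> q * ?E a"
      using abe by (intro odd_le) auto
    ultimately show ?thesis
      unfolding a_def e_def by blast
  qed

  show ?thesis
  proof (intro exI conjI allI impI)
    show "0 < 1 / q" "0 < - ln q / P"
      using q \<open>0 < P\<close> by (auto simp: divide_neg_pos)
    fix u0 u1 u ut and s :: real
    assume sol: "delayed_solution j B1 B1s B2 B2s \<tau> t u0 u1 u ut" and "0 < s"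
    show "energy u ut s \<le> 1 / q * exp (- (- ln q / P) * s) * energy u ut 0"
    proof (rule exponential_decay_if_contraction[OF \<open>0 < P\<close> q(1,2) energy_nonneg])
      fix n
      show "energy u ut r \<le> energy u ut (real n * P)" if "r \<in> {real n * P..real (Suc n) * P}" for r
        using step[OF sol, of n] that unfolding t_even t_even' by blast
      show "energy u ut (real (Suc n) * P) \<le> q * energy u ut (real n * P)"
        using step[OF sol, of n] unfolding t_even t_even' by blast
    qed (use \<open>0 < s\<close> in simp)
  qed
qed

end
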